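(* Let $G$ be a connected, compact and metrizable topological abelian group, equipped with its Borel $\sigma$-algebra. Let $X,Y$ be independent random variables on $G$ such that $\max\{h(X),h(Y)\}=h(Y)>-\infty$. Put $$s:=e^{6h(X)-2}\quad\text{and}\quad\eta_s:=\left(\frac{\sin(\pi s)}{\pi s}\right)^2.$$ Then $$h(X+Y)-h(Y)\geq\min\Bigl\{\frac14,\ \frac{(1-\eta_s)^2}{8+\frac{16\eta_s}{s}}\Bigr\}\,D(Y\|U_G).$$
   Context: Let $\mu$ be the unique Haar probability measure on $G$. For a $G$-valued random variable $X$, the entropy is $h(X):=-\int_G f\log f\,d\mu$ if the law of $X$ has a density $f$ with respect to $\mu$, and $h(X):=-\infty$ otherwise ($\log$ is the natural logarithm); one always has $h(X)\in[-\infty,0]$. $U_G$ denotes a random variable with law $\mu$, and $D(Y\|U_G)$ is the relative entropy between the laws of $Y$ and $U_G$, so that $D(Y\|U_G)=-h(Y)$. If $h(X)=-\infty$, then $s=0$ and the minimum on the right-hand side is read as its limiting value $0$ (with $\eta_0=1$). *)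

theory Defs
  imports "HOL-Probability.Probability"
begin

text \<open>Inside the class declaration \<^term>\<open>topology open\<close> is what the constant
  \<^const>\<open>euclidean\<close> abbreviates: the topology of the ambient type class. Metrizability includes the
  Hausdorff property; no metric is fixed.\<close>

class compact_connected_metrizable_ab_group = topological_ab_group_add +
  assumes compact_group: "compact (UNIV :: 'a set)"
    and connected_group: "connected (UNIV :: 'a set)"
    and metrizable_group: "metrizable_space (topology open)"

text \<open>Regularity is not required explicitly: every finite Borel measure on a compact metrizable
  space is regular.\<close>

definition haar_probability :: "'a::topological_group_add measure \<Rightarrow> bool" where
  "haar_probability \<mu> \<longleftrightarrow>
     prob_space \<mu> \<and> sets \<mu> = sets borel \<and> (\<forall>g. distr \<mu> borel (\<lambda>x. g + x) = \<mu>)"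

text \<open>The library's \<^const>\<open>prob_space.entropy\<close> is real-valued, and says nothing useful when there
  is no density or when the integral diverges. Here \<open>- f ln f\<close> is integrated as positive part minus
  negative part; since \<open>- f ln f \<le> 1/e\<close> and \<open>\<mu>\<close> will be finite, the positive part is finite, so that
  the difference is never \<open>\<infinity> - \<infinity>\<close>. A density is unique up to \<open>\<mu>\<close>-null sets, so it may be taken to be
  the Radon-Nikodym derivative.\<close>

definition haar_entropy :: "'m measure \<Rightarrow> 'a measure \<Rightarrow> ('m \<Rightarrow> 'a) \<Rightarrow> ereal" where
  "haar_entropy M \<mu> X =
    (if \<exists>f. distributed M \<mu> X f then
       (let f = (\<lambda>x. enn2real (RN_deriv \<mu> (distr M \<mu> X) x)) in
          enn2ereal (\<integral>\<^sup>+ x. ennreal (- (f x * ln (f x))) \<partial>\<mu>)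
        - enn2ereal (\<integral>\<^sup>+ x. ennreal (f x * ln (f x)) \<partial>\<mu>))
     else - \<infinity>)"

text \<open>The relative entropy \<open>D(Y \<parallel> U)\<close>, where \<open>U\<close> has law \<open>\<mu>\<close>. The library's Kullback-Leibler divergence
  takes the reference measure first. It is real-valued, hence meaningful only when the divergence
  is finite, that is, when \<open>haar_entropy M \<mu> Y > - \<infinity>\<close>.\<close>

definition rel_entropy_uniform :: "'m measure \<Rightarrow> 'a measure \<Rightarrow> ('m \<Rightarrow> 'a) \<Rightarrow> real" where
  "rel_entropy_uniform M \<mu> Y = KL_divergence (exp 1) \<mu> (distr M \<mu> Y)"

end

theory Submission
  imports Defs
begin

text \<open>Let \<open>g\<close> be the density of \<open>Y\<close>, \<open>q\<close> the density of \<open>X + Y\<close> and \<open>\<phi> t = t ln t - t + 1\<close>, so that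
  \<open>- h(Y) = \<integral> \<phi> g\<close>. The entropy gain dominates the mean Bregman divergence between the translates of
  \<open>g\<close> and their average \<open>q\<close>, and it controls \<open>\<integral> \<phi> g\<close> in two regimes. Finite entropy of \<open>X\<close> makes its law
  bounded by \<open>K\<close> times Haar measure up to mass \<open>1/6\<close>, so \<open>q\<close> is bounded along most translations and high
  peaks of \<open>g\<close> are flattened, each yielding a fixed share of its entropy. Where \<open>g\<close> is bounded, \<open>\<phi> g\<close> is
  at most a constant times \<open>(sqrt g - 1)\<^sup>2\<close>; a small gain gives many translations that almost fix
  \<open>sqrt g\<close> in \<open>L\<^sup>2\<close>, and since \<open>G\<close> is connected a bounded number of them adds up to any element, so
  \<open>sqrt g\<close> is almost constant. This replaces the Fourier estimate suggested by \<open>\<eta>\<close>. The resulting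
  constant is of order \<open>exp (- 26 D)\<close> with \<open>D = - h(X)\<close>, better than the claimed \<open>s\<^sup>5\<close>, which is of order
  \<open>exp (- 30 D)\<close>.\<close>


section \<open>Second countability of the group\<close>

text \<open>Finitely many balls of radius \<open>1 / (n + 1)\<close> cover the space, and over all
  \<open>n\<close> they form a basis. Second countability makes the group operations jointly
  measurable and lets continuity be tested on sequences.\<close>

lemma metrizable_compact_countable_basis:
  assumes "metrizable_space (euclidean :: 'a::topological_space topology)"
    and "compact (UNIV :: 'a set)"
  shows "\<exists>B :: 'a set set. countable B \<and> topological_basis B"
proof -
  obtain M d where "Metric_space M d"
    and top: "(euclidean :: 'a topology) = Metric_space.mtopology M d"
    using assms(1) unfolding metrizable_space_def by blast
  interpret Metric_space M d by fact
  have M: "M = UNIV"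
    using top topspace_mtopology by (metis topspace_euclidean)
  have open_iff: "open U \<longleftrightarrow> openin mtopology U" for U :: "'a set"
    by (simp add: open_openin top)
  have "\<exists>K. finite K \<and> UNIV \<subseteq> (\<Union>x\<in>K. mball x (1 / real (Suc n)))" for n
  proof -
    have "open (mball x (1 / real (Suc n)))" for x
      by (simp only: open_iff openin_mball)
    moreover have "UNIV \<subseteq> (\<Union>x. mball x (1 / real (Suc n)))"
    proof safe
      fix x
      have "x \<in> M" by (simp add: M)
      then have "x \<in> mball x (1 / real (Suc n))" by simp
      then show "x \<in> (\<Union>x. mball x (1 / real (Suc n)))" by blast
    qed
    ultimately show ?thesis
      using compactE_image[OF assms(2), of UNIV "\<lambda>x. mball x (1 / real (Suc n))"] by metis
  qed
  then obtain K where K: "\<And>n. finite (K n)"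
    and cov: "\<And>n. UNIV \<subseteq> (\<Union>x\<in>K n. mball x (1 / real (Suc n)))"
    by metis
  define B where "B = (\<Union>n. (\<lambda>x. mball x (1 / real (Suc n))) ` K n)"
  have "countable B"
    unfolding B_def using K by (intro countable_UN countable_image) (auto intro: countable_finite)
  moreover have "topological_basis B"
  proof (rule topological_basisI)
    show "open b" if "b \<in> B" for b
      using that by (auto simp: B_def open_iff)
  next
    fix U :: "'a set" and x assume "open U" "x \<in> U"
    then obtain e where e: "e > 0" "mball x e \<subseteq> U"
      unfolding open_iff openin_mtopology by auto
    obtain n where n: "1 / real (Suc n) < e / 2"
      using e(1) by (metis half_gt_zero nat_approx_posE)
    obtain y where y: "y \<in> K n" "x \<in> mball y (1 / real (Suc n))"
      using cov[of n] by blast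
    have "mball y (1 / real (Suc n)) \<subseteq> mball x e"
    proof
      fix z assume "z \<in> mball y (1 / real (Suc n))"
      then have "d y z < e / 2" using n by (simp only: in_mball) linarith
      moreover have "d y x < e / 2" using y n by (simp only: in_mball) linarith
      moreover have "x \<in> M" "y \<in> M" "z \<in> M" by (simp_all add: M)
      ultimately show "z \<in> mball x e"
        using triangle[of x y z] commute[of x y] unfolding in_mball by linarith
    qed
    then show "\<exists>b\<in>B. x \<in> b \<and> b \<subseteq> U"
      using y e(2) unfolding B_def by blast
  qed
  ultimately show ?thesis by blast
qed

instance compact_connected_metrizable_ab_group \<subseteq> second_countable_topology
proof
  obtain B :: "'a set set" where B: "countable B" "topological_basis B"
    using metrizable_compact_countable_basis[OF metrizable_group compact_group] by blast
  then have "open = generate_topology B"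
    by (simp add: topological_basis_imp_subbasis)
  then show "\<exists>B::'a set set. countable B \<and> open = generate_topology B"
    using B by blast
qed


subsection \<open>Connectedness and small symmetric sets\<close>

locale haar_group =
  fixes \<mu> :: "'a::compact_connected_metrizable_ab_group measure"
  assumes haar: "haar_probability \<mu>"
begin

sublocale prob_space \<mu>
  using haar by (simp add: haar_probability_def)

lemma sets_haar [simp, measurable_cong]: "sets \<mu> = sets borel"
  using haar by (simp add: haar_probability_def)

lemma space_haar [simp]: "space \<mu> = UNIV"
  using sets_eq_imp_space_eq[OF sets_haar] by simp

lemma prob_UNIV [simp]: "measure \<mu> UNIV = 1"
  using prob_space by simp

lemma distr_translate: "distr \<mu> borel (\<lambda>x. x + t) = \<mu>"
proof -
  have "(\<lambda>x. x + t) = (+) t" by (simp add: fun_eq_iff add.commute)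
  then show ?thesis using haar by (simp add: haar_probability_def)
qed

lemma nn_integral_translate:
  assumes [measurable]: "f \<in> borel_measurable borel"
  shows "(\<integral>\<^sup>+x. f (x + t) \<partial>\<mu>) = (\<integral>\<^sup>+x. f x \<partial>\<mu>)"
  by (subst (2) distr_translate[of t, symmetric]) (simp add: nn_integral_distr)

lemma nn_integral_translate_diff:
  assumes "f \<in> borel_measurable borel"
  shows "(\<integral>\<^sup>+x. f (x - t) \<partial>\<mu>) = (\<integral>\<^sup>+x. f x \<partial>\<mu>)"
  using nn_integral_translate[OF assms, of "- t"] by simp

lemma integrable_translate:
  fixes f :: "'a \<Rightarrow> real"
  assumes "integrable \<mu> f"
  shows "integrable \<mu> (\<lambda>x. f (x + t))"
proof (rule integrable_distr[of "\<lambda>x. x + t" \<mu> borel f])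
  show "integrable (distr \<mu> borel (\<lambda>x. x + t)) f"
    using assms by (simp add: distr_translate)
qed measurable

lemma integral_translate:
  fixes f :: "'a \<Rightarrow> real"
  assumes [measurable]: "f \<in> borel_measurable borel"
  shows "(\<integral>x. f (x + t) \<partial>\<mu>) = (\<integral>x. f x \<partial>\<mu>)"
  by (subst (2) distr_translate[of t, symmetric]) (simp add: integral_distr)

lemma measure_translate:
  assumes [measurable]: "A \<in> sets borel"
  shows "measure \<mu> {x. x + t \<in> A} = measure \<mu> A"
proof -
  have "measure \<mu> A = measure (distr \<mu> borel (\<lambda>x. x + t)) A"
    by (simp add: distr_translate)
  also have "\<dots> = measure \<mu> {x. x + t \<in> A}"
    by (subst measure_distr) (auto simp: vimage_def)
  finally show ?thesis by simp
qed

end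

text \<open>For symmetric \<open>E\<close> containing \<open>0\<close> these are the balls of the
  word metric with generating set \<open>E\<close>.\<close>

primrec word_ball :: "'a::group_add set \<Rightarrow> nat \<Rightarrow> 'a set" where
  "word_ball E 0 = {0}"
| "word_ball E (Suc n) = {a + b | a b. a \<in> word_ball E n \<and> b \<in> E}"

lemma word_ball_SucI: "a \<in> word_ball E n \<Longrightarrow> b \<in> E \<Longrightarrow> a + b \<in> word_ball E (Suc n)"
  by auto

text \<open>The union is stable under adding elements of \<open>E\<close>, hence open because
  \<open>E\<close> is a neighbourhood of \<open>0\<close>; symmetry of \<open>E\<close> makes the
  complement stable too, hence open. Connectedness leaves only the whole group.\<close>

lemma word_ball_Union_eq_UNIV:
  fixes E :: "'a::topological_ab_group_add set"
  assumes conn: "connected (UNIV :: 'a set)"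
    and E: "open E" "0 \<in> E" "\<And>x. x \<in> E \<Longrightarrow> - x \<in> E"
  shows "(\<Union>n. word_ball E n) = UNIV"
proof -
  let ?H = "\<Union>n. word_ball E n"
  have coset: "open {y. y - x \<in> E}" for x
  proof -
    have "open ((\<lambda>y. y - x) -` E)"
      by (intro open_vimage E continuous_intros)
    then show ?thesis by (simp add: vimage_def)
  qed
  have step: "y \<in> ?H" if xy: "x \<in> ?H" "y - x \<in> E" for x y
  proof -
    obtain n where "x \<in> word_ball E n" using xy by blast
    then have "x + (y - x) \<in> word_ball E (Suc n)" using xy(2) by (rule word_ball_SucI)
    then have "y \<in> word_ball E (Suc n)" by simp
    then show ?thesis by blast
  qed
  have "open ?H"
  proof (subst open_subopen, safe)
    fix x n assume "x \<in> word_ball E n"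
    then show "\<exists>T. open T \<and> x \<in> T \<and> T \<subseteq> ?H"
      using coset[of x] E(2) step[of x] by (intro exI[of _ "{y. y - x \<in> E}"]) auto
  qed
  moreover have "open (- ?H)"
  proof (subst open_subopen, rule ballI)
    fix x assume x: "x \<in> - ?H"
    have "y \<notin> ?H" if "y - x \<in> E" for y
      using step[of y x] E(3)[OF that] x by auto
    then show "\<exists>T. open T \<and> x \<in> T \<and> T \<subseteq> - ?H"
      using coset[of x] E(2) by (intro exI[of _ "{y. y - x \<in> E}"]) auto
  qed
  ultimately have "?H = {} \<or> ?H = UNIV"
    using conn by (auto simp: connected_clopen closed_def)
  moreover have "0 \<in> word_ball E 0" by simp
  ultimately show ?thesis by blast
qed

text \<open>Prefixes of a shortest word are shortest, since a shorter word for a prefix would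
  shorten the whole word. Cutting after \<open>j\<close> letters gives \<open>p\<close>.\<close>

lemma word_ball_levels:
  assumes "x \<in> word_ball E n" "\<And>i. i < n \<Longrightarrow> x \<notin> word_ball E i" "j \<le> n"
  shows "\<exists>p\<in>word_ball E j. \<forall>i<j. p \<notin> word_ball E i"
  using assms
proof (induction n arbitrary: x)
  case 0
  then show ?case by auto
next
  case (Suc n)
  obtain a b where ab: "x = a + b" "a \<in> word_ball E n" "b \<in> E"
    using Suc.prems(1) by auto
  have "a \<notin> word_ball E i" if "i < n" for i
    using Suc.prems(2)[of "Suc i"] that ab by auto
  then show ?case
    using Suc.IH[OF ab(2)] Suc.prems by (cases "j = Suc n") (auto simp del: word_ball.simps)
qed

text \<open>If the shortest word for \<open>t\<close> has length \<open>n\<close>, then elements of word length \<open>0, 3, 6, \<dots>\<close> up to \<open>n\<close>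
  have pairwise disjoint translates of \<open>E\<close>.\<close>

lemma (in haar_group) word_ball_diameter:
  assumes E: "open E" "0 \<in> E" "\<And>x. x \<in> E \<Longrightarrow> - x \<in> E"
  shows "\<exists>n. t \<in> word_ball E n \<and> real n * measure \<mu> E \<le> 3"
proof -
  define n where "n = (LEAST n. t \<in> word_ball E n)"
  have "t \<in> (\<Union>n. word_ball E n)"
    using word_ball_Union_eq_UNIV[OF connected_group E] by simp
  then have "\<exists>n. t \<in> word_ball E n" by blast
  then have tn: "t \<in> word_ball E n" "\<And>i. i < n \<Longrightarrow> t \<notin> word_ball E i"
    unfolding n_def by (auto intro: LeastI_ex dest: not_less_Least)
  have "\<exists>p. j \<le> n \<longrightarrow> p \<in> word_ball E j \<and> (\<forall>i<j. p \<notin> word_ball E i)" for j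
    using word_ball_levels[OF tn, of j] by blast
  then obtain p where p: "\<And>j. j \<le> n \<Longrightarrow> p j \<in> word_ball E j"
    "\<And>i j. j \<le> n \<Longrightarrow> i < j \<Longrightarrow> p j \<notin> word_ball E i"
    by metis
  define T where "T j = {x. x + - p (3 * j) \<in> E}" for j
  have [measurable]: "E \<in> sets borel" using E by simp
  have T_sets: "T j \<in> sets borel" for j unfolding T_def by measurable
  have disj: "T i \<inter> T j = {}" if "i < j" "3 * j \<le> n" for i j
  proof (rule ccontr)
    assume "T i \<inter> T j \<noteq> {}"
    then obtain x where x: "x + - p (3 * i) \<in> E" "x + - p (3 * j) \<in> E"
      unfolding T_def by auto
    have "p (3 * j) = p (3 * i) + (x + - p (3 * i)) + - (x + - p (3 * j))"
      by simp
    \<comment> \<open>A common point would write \<open>p (3 * j)\<close> with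
      \<open>3 * i + 2\<close> letters, fewer than \<open>3 * j\<close>; this is why the levels are
      spaced by three.\<close>
    also have "\<dots> \<in> word_ball E (Suc (Suc (3 * i)))"
      using p(1)[of "3 * i"] x(1) E(3)[OF x(2)] that by (intro word_ball_SucI) auto
    finally show False using p(2)[of "3 * j" "Suc (Suc (3 * i))"] that by simp
  qed
  \<comment> \<open>The levels \<open>0, 3, ..., 3 * (n div 3)\<close> give
    \<open>n div 3 + 1\<close> disjoint translates of equal measure, and \<open>n\<close> is at most
    three times their number.\<close>
  have "real (Suc (n div 3)) * measure \<mu> E = (\<Sum>j\<in>{..n div 3}. measure \<mu> (T j))"
    unfolding T_def by (simp add: measure_translate del: add_uminus_conv_diff)
  also have "\<dots> = measure \<mu> (\<Union>j\<in>{..n div 3}. T j)"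
  proof (rule finite_measure_finite_Union[symmetric])
    have "T i \<inter> T j = {}" if "i \<le> n div 3" "j \<le> n div 3" "i \<noteq> j" for i j
    proof -
      have "3 * i \<le> n" "3 * j \<le> n" using that by auto
      then show ?thesis
        using disj[of i j] disj[of j i] that(3) by (cases "i < j") (auto simp: Int_commute)
    qed
    then show "disjoint_family_on T {..n div 3}"
      by (auto simp: disjoint_family_on_def)
  qed (use T_sets in auto)
  also have "\<dots> \<le> 1" by (rule prob_le_1)
  finally have "real (Suc (n div 3)) * measure \<mu> E \<le> 1" .
  moreover have "real n * measure \<mu> E \<le> (3 * real (Suc (n div 3))) * measure \<mu> E"
  proof (rule mult_right_mono)
    have "n \<le> 3 * Suc (n div 3)" by simp
    then show "real n \<le> 3 * real (Suc (n div 3))" by linarith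
  qed simp
  ultimately show ?thesis using tn(1) by (intro exI[of _ n]) linarith
qed

text \<open>For nonnegative \<open>W\<close>, optimising \<open>tri\<close> over \<open>c\<close>
  says that \<open>sqrt W\<close> is subadditive; the weighted form avoids square roots. So
  \<open>n\<close> steps of size \<open>sqrt \<delta>\<close> add up to at most
  \<open>n * sqrt \<delta>\<close>.\<close>

lemma word_ball_quadratic_bound:
  fixes W :: "'a::group_add \<Rightarrow> real"
  assumes W0: "W 0 = 0"
    and tri: "\<And>s t c. c > 0 \<Longrightarrow> W (s + t) \<le> (1 + 1 / c) * W s + (1 + c) * W t"
    and E: "\<And>t. t \<in> E \<Longrightarrow> W t \<le> \<delta>"
    and t: "t \<in> word_ball E n"
  shows "W t \<le> (real n)\<^sup>2 * \<delta>"
  using t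
proof (induction n arbitrary: t)
  case 0
  then show ?case using W0 by simp
next
  case (Suc n)
  then obtain a b where ab: "t = a + b" "a \<in> word_ball E n" "b \<in> E" by auto
  show ?case
  proof (cases "n = 0")
    case True
    then show ?thesis using ab E[of b] by simp
  next
    case False
    \<comment> \<open>The weight \<open>c = n\<close> closes the induction:
      \<open>(1 + 1 / n) * n^2 + (1 + n) = (n + 1)^2\<close>. Length \<open>0\<close> is split off
      because it would give \<open>c = 0\<close>.\<close>
    have "W t \<le> (1 + 1 / real n) * W a + (1 + real n) * W b"
      using tri[of "real n" a b] False ab by simp
    also have "\<dots> \<le> (1 + 1 / real n) * ((real n)\<^sup>2 * \<delta>) + (1 + real n) * \<delta>"
      using Suc.IH[OF ab(2)] E[OF ab(3)] by (intro add_mono mult_left_mono) auto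
    also have "\<dots> = (real (Suc n))\<^sup>2 * \<delta>"
      using False by (simp add: field_simps power2_eq_square)
    finally show ?thesis .
  qed
qed

text \<open>The sublevel set is an open symmetric neighbourhood of \<open>0\<close>, so by
  connectedness every \<open>t\<close> is a sum of at most \<open>3 / \<epsilon>\<close> of its
  elements. Smallness on a set of positive measure thus becomes a global bound.\<close>

lemma (in haar_group) sublevel_growth:
  fixes W :: "'a \<Rightarrow> real"
  assumes W0: "W 0 = 0" and sym: "\<And>t. W (- t) = W t" and cont: "continuous_on UNIV W"
    and tri: "\<And>s t c. c > 0 \<Longrightarrow> W (s + t) \<le> (1 + 1 / c) * W s + (1 + c) * W t"
    and \<delta>: "\<delta> > 0" and \<epsilon>: "\<epsilon> > 0" "\<epsilon> \<le> measure \<mu> {t. W t < \<delta>}"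
  shows "W t \<le> (3 / \<epsilon>)\<^sup>2 * \<delta>"
proof -
  let ?E = "{t. W t < \<delta>}"
  have "open ?E" using cont by (intro open_Collect_less) auto
  then obtain n where n: "t \<in> word_ball ?E n" "real n * measure \<mu> ?E \<le> 3"
    using word_ball_diameter[of ?E t] W0 sym \<delta> by auto
  have "real n * \<epsilon> \<le> 3"
    using n(2) \<epsilon>(2) by (meson mult_left_mono of_nat_0_le_iff order_trans)
  then have "real n \<le> 3 / \<epsilon>"
    using \<epsilon> by (simp add: field_simps)
  then have "(real n)\<^sup>2 * \<delta> \<le> (3 / \<epsilon>)\<^sup>2 * \<delta>"
    using \<delta> by (intro mult_right_mono power_mono) auto
  moreover have "W t \<le> (real n)\<^sup>2 * \<delta>"
    by (rule word_ball_quadratic_bound[where W = W, OF W0 tri _ n(1)]) auto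
  ultimately show ?thesis by linarith
qed

subsection \<open>Continuity of translation in the mean\<close>

lemma (in haar_group) integral_abs_translate:
  fixes f :: "'a \<Rightarrow> real"
  assumes "integrable \<mu> f"
  shows "(\<integral>x. \<bar>f (x + t)\<bar> \<partial>\<mu>) = (\<integral>x. \<bar>f x\<bar> \<partial>\<mu>)"
  using integral_translate[of "\<lambda>x. \<bar>f x\<bar>" t] assms by simp

definition (in haar_group) translation_modulus :: "('a \<Rightarrow> real) \<Rightarrow> 'a \<Rightarrow> real" where
  "translation_modulus f t = (\<integral>x. \<bar>f (x + t) - f x\<bar> \<partial>\<mu>)"

lemma (in haar_group) translation_modulus_nonneg: "translation_modulus f t \<ge> 0"
  by (simp add: translation_modulus_def)

lemma (in haar_group) translation_modulus_perturb:
  assumes f[simp]: "integrable \<mu> f" and g[simp]: "integrable \<mu> g"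
  shows "translation_modulus f t \<le> translation_modulus g t + 2 * (\<integral>x. \<bar>g x - f x\<bar> \<partial>\<mu>)"
proof -
  note [simp] = integrable_translate[OF f] integrable_translate[OF g]
  have "translation_modulus f t \<le>
      (\<integral>x. \<bar>g (x + t) - g x\<bar> + (\<bar>g (x + t) - f (x + t)\<bar> + \<bar>g x - f x\<bar>) \<partial>\<mu>)"
    unfolding translation_modulus_def
    by (intro integral_mono Bochner_Integration.integrable_add integrable_abs
        Bochner_Integration.integrable_diff) auto
  also have "\<dots> = translation_modulus g t
      + ((\<integral>x. \<bar>g (x + t) - f (x + t)\<bar> \<partial>\<mu>) + (\<integral>x. \<bar>g x - f x\<bar> \<partial>\<mu>))"
    unfolding translation_modulus_def by simp
  also have "(\<integral>x. \<bar>g (x + t) - f (x + t)\<bar> \<partial>\<mu>) = (\<integral>x. \<bar>g x - f x\<bar> \<partial>\<mu>)"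
    using integral_abs_translate[of "\<lambda>x. g x - f x" t] by simp
  finally show ?thesis by simp
qed

lemma (in haar_group) translation_modulus_limit:
  assumes f: "integrable \<mu> f" and s: "\<And>i. integrable \<mu> (s i)"
    and lim: "(\<lambda>i. \<integral>x. \<bar>s i x - f x\<bar> \<partial>\<mu>) \<longlonglongrightarrow> 0"
    and cont: "\<And>i::nat. (\<lambda>n. translation_modulus (s i) (T n)) \<longlonglongrightarrow> 0"
  shows "(\<lambda>n. translation_modulus f (T n)) \<longlonglongrightarrow> 0"
proof (rule LIMSEQ_I)
  fix r :: real assume r: "r > 0"
  \<comment> \<open>The approximation error enters twice, at \<open>x\<close> and at
    \<open>x + T n\<close>.\<close>
  obtain i where i: "(\<integral>x. \<bar>s i x - f x\<bar> \<partial>\<mu>) < r / 4"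
    using LIMSEQ_D[OF lim, of "r / 4"] r by auto
  obtain N where "\<And>n. n \<ge> N \<Longrightarrow> translation_modulus (s i) (T n) < r / 2"
    using LIMSEQ_D[OF cont[of i], of "r / 2"] r by (auto simp: translation_modulus_nonneg)
  then have "translation_modulus f (T n) < r" if "n \<ge> N" for n
    using translation_modulus_perturb[OF f s[of i], of "T n"] i that by fastforce
  then show "\<exists>N. \<forall>n\<ge>N. norm (translation_modulus f (T n) - 0) < r"
    by (auto simp: translation_modulus_nonneg)
qed

lemma (in haar_group) translation_modulus_add:
  assumes "integrable \<mu> f" "integrable \<mu> g"
    and "(\<lambda>n. translation_modulus f (T n)) \<longlonglongrightarrow> 0"
    and "(\<lambda>n. translation_modulus g (T n)) \<longlonglongrightarrow> 0"
  shows "(\<lambda>n::nat. translation_modulus (\<lambda>x. f x + g x) (T n)) \<longlonglongrightarrow> 0"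
proof (rule tendsto_sandwich[where f = "\<lambda>_. 0"])
  show "\<forall>\<^sub>F n in sequentially. translation_modulus (\<lambda>x. f x + g x) (T n)
      \<le> translation_modulus f (T n) + translation_modulus g (T n)"
  proof (intro always_eventually allI)
    fix n
    note [simp] = assms(1,2) integrable_translate[OF assms(1)] integrable_translate[OF assms(2)]
    have "translation_modulus (\<lambda>x. f x + g x) (T n)
        \<le> (\<integral>x. \<bar>f (x + T n) - f x\<bar> + \<bar>g (x + T n) - g x\<bar> \<partial>\<mu>)"
      unfolding translation_modulus_def
      by (intro integral_mono Bochner_Integration.integrable_add integrable_abs
          Bochner_Integration.integrable_diff) auto
    then show "translation_modulus (\<lambda>x. f x + g x) (T n)
      \<le> translation_modulus f (T n) + translation_modulus g (T n)"
      by (simp add: translation_modulus_def)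
  qed
  show "(\<lambda>n. translation_modulus f (T n) + translation_modulus g (T n)) \<longlonglongrightarrow> 0"
    using tendsto_add[OF assms(3,4)] by simp
qed (auto intro!: always_eventually simp: translation_modulus_nonneg)

text \<open>Only leaving \<open>U\<close> needs a limit argument: a point of the open set stays
  inside under small translations, and a point outside contributes nothing. By invariance entering
  and leaving have equal measure, so the modulus is twice the loss.\<close>

lemma (in haar_group) translation_modulus_open:
  assumes "open U" and T: "T \<longlonglongrightarrow> 0"
  shows "(\<lambda>n. translation_modulus (indicator U) (T n)) \<longlonglongrightarrow> 0"
proof -
  have [measurable]: "U \<in> sets borel" using assms by simp
  let ?u = "indicator U :: 'a \<Rightarrow> real"
  have int[simp]: "integrable \<mu> ?u" by (simp add: integrable_indicator_iff less_top[symmetric])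
  note [simp] = integrable_translate[OF int]
  have "(\<lambda>n. \<integral>x. max 0 (?u x - ?u (x + T n)) \<partial>\<mu>) \<longlonglongrightarrow> (\<integral>x. 0 \<partial>\<mu>)"
  proof (rule integral_dominated_convergence[where w = "\<lambda>_. 1"])
    show "AE x in \<mu>. (\<lambda>n. max 0 (?u x - ?u (x + T n))) \<longlonglongrightarrow> 0"
    proof (rule AE_I2)
      fix x
      show "(\<lambda>n. max 0 (?u x - ?u (x + T n))) \<longlonglongrightarrow> 0"
      proof (cases "x \<in> U")
        case True
        have "(\<lambda>n. x + T n) \<longlonglongrightarrow> x + 0" by (intro tendsto_intros T)
        then have "\<forall>\<^sub>F n in sequentially. x + T n \<in> U"
          using \<open>open U\<close> True by (auto dest: topological_tendstoD)
        then have "\<forall>\<^sub>F n in sequentially. max 0 (?u x - ?u (x + T n)) = 0"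
          by eventually_elim (simp add: indicator_def)
        then show ?thesis by (rule tendsto_eventually)
      qed (simp add: indicator_def)
    qed
  qed (auto simp: indicator_def)
  moreover have "translation_modulus ?u t = 2 * (\<integral>x. max 0 (?u x - ?u (x + t)) \<partial>\<mu>)" for t
  proof -
    have "integrable \<mu> (\<lambda>x. max 0 (?u x - ?u (x + t)))"
      by (intro integrable_max) auto
    moreover have "\<bar>?u (x + t) - ?u x\<bar> = (?u (x + t) - ?u x) + 2 * max 0 (?u x - ?u (x + t))" for x
      by (auto simp: indicator_def)
    ultimately have "translation_modulus ?u t = ((\<integral>x. ?u (x + t) \<partial>\<mu>) - (\<integral>x. ?u x \<partial>\<mu>))
        + 2 * (\<integral>x. max 0 (?u x - ?u (x + t)) \<partial>\<mu>)"
      unfolding translation_modulus_def by simp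
    then show ?thesis using integral_translate[of ?u t] by simp
  qed
  ultimately show ?thesis
    using tendsto_mult[OF tendsto_const[of "2::real"]] by fastforce
qed

text \<open>Induction over Borel sets from the intersection-stable class of open sets: complements
  have the same modulus, and a disjoint union is an \<open>L1\<close> limit of finite sums of
  indicators.\<close>

lemma (in haar_group) translation_modulus_indicator:
  assumes A: "A \<in> sets borel" and T: "T \<longlonglongrightarrow> 0"
  shows "(\<lambda>n. translation_modulus (indicator A) (T n)) \<longlonglongrightarrow> 0"
proof -
  have sets: "sets borel = sigma_sets (UNIV :: 'a set) {U. open U}"
    by (simp add: borel_def)
  have int: "integrable \<mu> (indicator B :: 'a \<Rightarrow> real)" if "B \<in> sigma_sets UNIV {U. open U}" for B
    using that unfolding sets[symmetric] by (simp add: integrable_indicator_iff less_top[symmetric])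
  have "Int_stable {U :: 'a set. open U}" "{U :: 'a set. open U} \<subseteq> Pow UNIV"
    by (auto simp: Int_stable_def)
  then show ?thesis
    using A unfolding sets
  proof (induction rule: sigma_sets_induct_disjoint)
    case (basic U)
    then show ?case using translation_modulus_open T by simp
  next
    case empty
    then show ?case by (simp add: translation_modulus_def)
  next
    case (compl B)
    have "\<bar>indicator (UNIV - B) y - indicator (UNIV - B) x\<bar>
        = \<bar>indicator B y - indicator B x :: real\<bar>" for x y
      by (simp add: indicator_def)
    then show ?case using compl by (simp add: translation_modulus_def)
  next
    case (union B)
    have [measurable]: "B i \<in> sets borel" for i using union by (auto simp: sets)
    define s where "s n = (\<lambda>x. \<Sum>i<n. indicator (B i) x :: real)" for n
    have s_eq: "s n = indicator (\<Union>i<n. B i)" for n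
      unfolding s_def using union(1)
      by (intro ext indicator_UN_disjoint[symmetric]) (auto simp: disjoint_family_on_def)
    have s_int: "integrable \<mu> (s n)" for n
      unfolding s_eq by (simp add: integrable_indicator_iff less_top[symmetric])
    show ?case
    proof (rule translation_modulus_limit)
      show "integrable \<mu> (s n)" for n by (rule s_int)
      show "integrable \<mu> (indicator (\<Union>i. B i) :: 'a \<Rightarrow> real)"
        by (simp add: integrable_indicator_iff less_top[symmetric])
      show "(\<lambda>n. translation_modulus (s i) (T n)) \<longlonglongrightarrow> 0" for i
      proof (induction i)
        case 0
        then show ?case by (simp add: translation_modulus_def s_def)
      next
        case (Suc i)
        have "s (Suc i) = (\<lambda>x. s i x + indicator (B i) x)" by (simp add: s_def)
        then show ?case
          using translation_modulus_add[OF s_int int Suc.IH union(3)] union by (auto simp: image_subset_iff)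
      qed
      have "(\<lambda>n. \<integral>x. \<bar>s n x - indicator (\<Union>i. B i) x\<bar> \<partial>\<mu>) \<longlonglongrightarrow> (\<integral>x. 0 \<partial>\<mu>)"
      proof (rule integral_dominated_convergence[where w = "\<lambda>_. 1"])
        show "AE x in \<mu>. (\<lambda>n. \<bar>s n x - indicator (\<Union>i. B i) x\<bar>) \<longlonglongrightarrow> 0"
        proof (rule AE_I2)
          fix x
          have "(\<lambda>n. s n x) \<longlonglongrightarrow> indicator (\<Union>i. B i) x"
            unfolding s_eq by (rule LIMSEQ_indicator_UN)
          then show "(\<lambda>n. \<bar>s n x - indicator (\<Union>i. B i) x\<bar>) \<longlonglongrightarrow> 0"
            by (simp add: LIM_zero tendsto_rabs_zero)
        qed
      qed (auto simp: s_eq indicator_def)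
      then show "(\<lambda>n. \<integral>x. \<bar>s n x - indicator (\<Union>i. B i) x\<bar> \<partial>\<mu>) \<longlonglongrightarrow> 0"
        by simp
    qed
  qed
qed

text \<open>Scaling, sums and \<open>L1\<close> limits lead from indicators to all integrable
  functions. For the density of \<open>Y\<close> this yields the continuity of
  \<open>W\<close>.\<close>

lemma (in haar_group) translation_modulus_tendsto_0:
  fixes f :: "'a \<Rightarrow> real"
  assumes "integrable \<mu> f" and T: "T \<longlonglongrightarrow> 0"
  shows "(\<lambda>n. translation_modulus f (T n)) \<longlonglongrightarrow> 0"
  using assms(1)
proof induction
  case (base A c)
  have "translation_modulus (\<lambda>x. indicator A x *\<^sub>R c) t = \<bar>c\<bar> * translation_modulus (indicator A) t"
    for t
    by (simp add: translation_modulus_def abs_mult mult.commute[of _ c] flip: right_diff_distrib)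
  then show ?case
    using tendsto_mult_right_zero[OF translation_modulus_indicator[OF _ T, of A], of "\<bar>c\<bar>"] base
    by simp
next
  case (add f g)
  then show ?case by (intro translation_modulus_add) auto
next
  case (lim f s)
  show ?case
  proof (rule translation_modulus_limit)
    show "(\<lambda>i. \<integral>x. \<bar>s i x - f x\<bar> \<partial>\<mu>) \<longlonglongrightarrow> 0"
    proof -
      have "(\<lambda>i. \<integral>x. \<bar>s i x - f x\<bar> \<partial>\<mu>) \<longlonglongrightarrow> (\<integral>x. 0 \<partial>\<mu>)"
      \<comment> \<open>The induction rule provides
        \<open>norm (s i x) \<le> 2 * norm (f x)\<close>, hence the factor 3.\<close>
      proof (rule integral_dominated_convergence[where w = "\<lambda>x. 3 * \<bar>f x\<bar>"])
        show "AE x in \<mu>. (\<lambda>i. \<bar>s i x - f x\<bar>) \<longlonglongrightarrow> 0"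
          using lim by (intro AE_I2) (simp add: LIM_zero tendsto_rabs_zero)
        show "AE x in \<mu>. norm \<bar>s i x - f x\<bar> \<le> 3 * \<bar>f x\<bar>" for i
        proof (rule AE_I2)
          fix x assume "x \<in> space \<mu>"
          then have "norm (s i x) \<le> 2 * norm (f x)" using lim by simp
          then show "norm \<bar>s i x - f x\<bar> \<le> 3 * \<bar>f x\<bar>" by simp
        qed
      qed (use lim in auto)
      then show ?thesis by simp
    qed
  qed (use lim in auto)
qed

text \<open>Applying \<open>tri\<close> from \<open>t\<close> to \<open>t + h\<close> and back
  bounds the increment by \<open>C / c + (1 + c) * W h\<close>. Boundedness lets a large
  \<open>c\<close> make the first term small; then \<open>h\<close> tending to \<open>0\<close>
  handles the second.\<close>

lemma quasi_triangle_continuous: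
  fixes W :: "'a::{first_countable_topology, topological_ab_group_add} \<Rightarrow> real"
  assumes nonneg: "\<And>t. 0 \<le> W t" and bounded: "\<And>t. W t \<le> C" and sym: "\<And>t. W (- t) = W t"
    and tri: "\<And>s t c. c > 0 \<Longrightarrow> W (s + t) \<le> (1 + 1 / c) * W s + (1 + c) * W t"
    and lim: "\<And>T::nat \<Rightarrow> 'a. T \<longlonglongrightarrow> 0 \<Longrightarrow> (\<lambda>n. W (T n)) \<longlonglongrightarrow> 0"
  shows "continuous_on UNIV W"
  unfolding continuous_on_def tendsto_at_iff_sequentially comp_def
proof (intro ballI allI impI)
  fix U :: "nat \<Rightarrow> 'a" and t assume U: "U \<longlonglongrightarrow> t"
  have "(\<lambda>n. U n - t) \<longlonglongrightarrow> t - t" by (intro tendsto_intros U)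
  then have h: "(\<lambda>n. W (U n - t)) \<longlonglongrightarrow> 0" by (intro lim) simp
  have C: "C \<ge> 0" using nonneg[of 0] bounded[of 0] by linarith
  have est: "\<bar>W (t + h) - W t\<bar> \<le> C / c + (1 + c) * W h" if "c > 0" for c h
  proof -
    have "W (t + h) \<le> (1 + 1 / c) * W t + (1 + c) * W h" by (rule tri[OF that])
    moreover have "W t \<le> (1 + 1 / c) * W (t + h) + (1 + c) * W h"
      using tri[OF that, of "t + h" "- h"] sym[of h] by simp
    moreover have "W t / c \<le> C / c" "W (t + h) / c \<le> C / c"
      using that bounded by (auto intro: divide_right_mono)
    ultimately show ?thesis by (simp add: distrib_right abs_le_iff)
  qed
  show "(\<lambda>n. W (U n)) \<longlonglongrightarrow> W t"
  proof (rule LIMSEQ_I)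
    fix r :: real assume r: "r > 0"
    define c where "c = 2 * (C + 1) / r"
    have c: "c > 0" "C / c < r / 2" using r C by (auto simp: c_def field_simps)
    obtain N where N: "\<And>n. n \<ge> N \<Longrightarrow> W (U n - t) < r / 2 / (1 + c)"
      using LIMSEQ_D[OF h, of "r / 2 / (1 + c)"] r c nonneg by auto
    have N': "(1 + c) * W (U n - t) < r / 2" if "n \<ge> N" for n
      using N[OF that] c(1) by (simp add: pos_less_divide_eq algebra_simps)
    then have "\<bar>W (U n) - W t\<bar> < r" if "n \<ge> N" for n
    proof -
      have "t + (U n - t) = U n" by simp
      then show ?thesis
        using est[OF c(1), of "U n - t"] c(2) N'[OF that] by (simp only:)
    qed
    then show "\<exists>N. \<forall>n\<ge>N. norm (W (U n) - W t) < r" by auto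
  qed
qed

subsection \<open>Bregman divergence and convolution\<close>

text \<open>This is \<open>t ln t\<close> minus its tangent at \<open>1\<close>. On a probability
  density the tangent \<open>t - 1\<close> integrates to \<open>0\<close>, so relative entropies
  become integrals of a nonnegative function and can live in \<open>ennreal\<close>.\<close>

definition phi :: "real \<Rightarrow> real" where "phi t = t * ln t - t + 1"

lemma phi_measurable [measurable]: "phi \<in> borel_measurable borel"
  unfolding phi_def[abs_def] by measurable

lemma phi_nonneg:
  assumes "t \<ge> 0"
  shows "phi t \<ge> 0"
proof (cases "t = 0")
  case False
  then have "ln (1 / t) \<le> 1 / t - 1" using assms by (intro ln_le_minus_one) auto
  then have "t * ln (1 / t) \<le> t * (1 / t - 1)" using assms by (rule mult_left_mono)
  then show ?thesis using False assms by (simp add: phi_def ln_div algebra_simps)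
qed (simp add: phi_def)

text \<open>At \<open>1\<close> both sides vanish to second order, and for large \<open>a\<close>
  the ratio of \<open>phi a\<close> to the square grows like \<open>ln a\<close>, whence the bound
  \<open>L\<close>. Entropy of a bounded density is thereby controlled by an \<open>L2\<close>
  distance of its square root from \<open>1\<close>.\<close>

lemma phi_le_sqrt_diff:
  assumes "0 \<le> a" "a \<le> L" "1 \<le> L"
  shows "phi a \<le> (4 + ln L) * (sqrt a - 1)\<^sup>2"
proof -
  define u where "u = sqrt a"
  have u: "u \<ge> 0" "a = u\<^sup>2" using assms by (auto simp: u_def)
  have lnL: "ln L \<ge> 0" using assms by simp
  consider "a = 0" | "0 < a" "a < 1" | "1 \<le> a" using assms by linarith
  then have "phi a \<le> (4 + ln L) * (u - 1)\<^sup>2"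
  proof cases
    case 1
    then show ?thesis using u lnL by (simp add: phi_def)
  next
    case 2
    then have "u < 1" by (simp add: u_def)
    have "a * ln a \<le> a * (a - 1)"
      using 2 by (intro mult_left_mono ln_le_minus_one) auto
    then have "phi a \<le> (a - 1)\<^sup>2" by (simp add: phi_def power2_eq_square algebra_simps)
    also have "\<dots> = (u + 1)\<^sup>2 * (u - 1)\<^sup>2" by (simp add: u power2_eq_square algebra_simps)
    also have "\<dots> \<le> (4 + ln L) * (u - 1)\<^sup>2"
    proof (rule mult_right_mono)
      have "(u + 1)\<^sup>2 \<le> 2\<^sup>2" using u \<open>u < 1\<close> by (intro power_mono) auto
      then show "(u + 1)\<^sup>2 \<le> 4 + ln L" using lnL by simp
    qed simp
    finally show ?thesis .
  next
    case 3
    then have u1: "u \<ge> 1" by (simp add: u_def)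
    have ln_a: "ln a = 2 * ln u" using u u1 by (simp add: ln_realpow)
    \<comment> \<open>The difference \<open>(4 + ln a) * (u - 1)^2 - phi a\<close> equals
      \<open>4 * (u - 1)^2 - 2 * (2 * u - 1) * ln u + u^2 - 1\<close>; inserting
      \<open>ln u \<le> u - 1\<close> leaves at least \<open>(u - 1)^2\<close>.\<close>
    have "(2 * (2 * u - 1)) * ln u \<le> (2 * (2 * u - 1)) * (u - 1)"
      using u1 by (intro mult_left_mono ln_le_minus_one) auto
    moreover have "0 \<le> (u - 1)\<^sup>2" by simp
    ultimately have "phi a \<le> (4 + ln a) * (u - 1)\<^sup>2"
      unfolding phi_def ln_a unfolding u(2) by (simp add: power2_eq_square algebra_simps)
    also have "\<dots> \<le> (4 + ln L) * (u - 1)\<^sup>2"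
      using assms 3 by (intro mult_right_mono) auto
    finally show ?thesis .
  qed
  then show ?thesis by (simp add: u_def)
qed

text \<open>Bregman divergence of \<open>t ln t\<close>. At \<open>b = 0\<close> and
  \<open>a \<noteq> 0\<close> the convention \<open>ln 0 = 0\<close> would give a finite number, so
  the value infinity is set by hand.\<close>

definition bregman :: "real \<Rightarrow> real \<Rightarrow> ennreal" where
  "bregman a b = (if b = 0 \<and> a \<noteq> 0 then \<top> else ennreal (a * ln a - a * ln b - a + b))"

lemma bregman_measurable [measurable]:
  assumes [measurable]: "f \<in> borel_measurable M" "h \<in> borel_measurable M"
  shows "(\<lambda>x. bregman (f x) (h x)) \<in> borel_measurable M"
  unfolding bregman_def by measurable

text \<open>Pointwise form of the bound of squared Hellinger distance by relative entropy:
  \<open>ln x \<le> x - 1\<close> at \<open>x = sqrt (b / a)\<close>, multiplied by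
  \<open>2 * a\<close>.\<close>

lemma bregman_ge_sqrt_diff:
  assumes "a \<ge> 0" "b \<ge> 0"
  shows "ennreal ((sqrt a - sqrt b)\<^sup>2) \<le> bregman a b"
proof -
  consider "a = 0" | "a > 0" "b = 0" | "a > 0" "b > 0" using assms by linarith
  then show ?thesis
  proof cases
    case 3
    define u v where "u = sqrt a" and "v = sqrt b"
    have uv: "u > 0" "v > 0" "a = u\<^sup>2" "b = v\<^sup>2" using 3 by (auto simp: u_def v_def)
    have "ln (v / u) \<le> v / u - 1" using uv by (intro ln_le_minus_one) auto
    then have "(2 * u\<^sup>2) * ln (v / u) \<le> (2 * u\<^sup>2) * (v / u - 1)" by (rule mult_left_mono) simp
    then have "(u - v)\<^sup>2 \<le> u\<^sup>2 * (2 * ln u) - u\<^sup>2 * (2 * ln v) - u\<^sup>2 + v\<^sup>2"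
      using uv by (simp add: ln_div power2_eq_square algebra_simps)
    also have "\<dots> = a * ln a - a * ln b - a + b"
      using uv by (simp add: ln_realpow)
    finally have "(u - v)\<^sup>2 \<le> a * ln a - a * ln b - a + b" .
    then show ?thesis using 3 by (simp add: bregman_def u_def v_def ennreal_leI)
  qed (use assms in \<open>auto simp: bregman_def\<close>)
qed

text \<open>The threshold for \<open>a\<close> is made so that
  \<open>ln b \<le> ln a / 2 - 1\<close>: the square halves the logarithm, and the factor
  \<open>exp 1\<close> compensates the term \<open>- a\<close>.\<close>

lemma bregman_ge_half_phi:
  assumes "1 \<le> M" "(exp 1 * M)\<^sup>2 \<le> a" "0 \<le> b" "b \<le> M"
  shows "ennreal (phi a / 2) \<le> bregman a b"
proof (cases "b = 0")
  case True
  have "0 < (exp 1 * M)\<^sup>2" using assms(1) by simp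
  then have "0 < a" using assms(2) by linarith
  then show ?thesis using True by (simp add: bregman_def)
next
  case False
  have e: "1 \<le> exp 1 * M" using mult_mono[of 1 "exp 1" 1 M] assms(1) by simp
  then have a1: "1 \<le> a" using assms(2) one_le_power[OF e, of 2] by linarith
  have "0 < (exp 1 * M)\<^sup>2" using assms(1) by simp
  then have "ln ((exp 1 * M)\<^sup>2) \<le> ln a" using assms(2) by (intro ln_mono) auto
  then have "2 + 2 * ln M \<le> ln a" using assms(1) by (simp add: ln_realpow ln_mult)
  moreover have "ln b \<le> ln M" using False assms by simp
  ultimately have "ln b \<le> ln a / 2 - 1" by simp
  then have "a * ln b \<le> a * (ln a / 2 - 1)" using a1 by (intro mult_left_mono) auto
  then have "a * ln b \<le> (a * ln a) / 2 - a" by (simp add: right_diff_distrib)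
  moreover have "(p - a + 1) / 2 \<le> p - r - a + b" if "r \<le> p / 2 - a" for p r
    using that a1 assms(3) by (simp add: field_simps)
  ultimately have "phi a / 2 \<le> a * ln a - a * ln b - a + b"
    unfolding phi_def by blast
  then show ?thesis using False by (simp add: bregman_def ennreal_leI)
qed

text \<open>Jensen's inequality with its defect: \<open>bregman (h x) m\<close> is
  \<open>phi (h x)\<close> minus the tangent of \<open>phi\<close> at the mean \<open>m\<close>, and
  the linear part of the tangent has mean zero. At \<open>m = 0\<close>, where the slope
  \<open>ln m\<close> degenerates, \<open>h\<close> vanishes almost everywhere.\<close>

lemma (in prob_space) bregman_jensen:
  assumes int: "integrable M h" and nonneg: "\<And>x. h x \<ge> 0"
  shows "ennreal (phi (expectation h)) + (\<integral>\<^sup>+x. bregman (h x) (expectation h) \<partial>M)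
    \<le> (\<integral>\<^sup>+x. ennreal (phi (h x)) \<partial>M)"
proof -
  have [measurable]: "h \<in> borel_measurable M" using int by simp
  define m where "m = expectation h"
  have m: "m \<ge> 0" unfolding m_def using nonneg by simp
  consider "m = 0" | "m > 0" "(\<integral>\<^sup>+x. ennreal (phi (h x)) \<partial>M) = \<infinity>"
    | "m > 0" "(\<integral>\<^sup>+x. ennreal (phi (h x)) \<partial>M) < \<infinity>"
    using m by (metis less_eq_real_def infinity_ennreal_def less_top)
  then have "ennreal (phi m) + (\<integral>\<^sup>+x. bregman (h x) m \<partial>M) \<le> (\<integral>\<^sup>+x. ennreal (phi (h x)) \<partial>M)"
  proof cases
    case 1
    then have "AE x in M. h x = 0"
      using integral_nonneg_eq_0_iff_AE[OF int] nonneg by (simp add: m_def)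
    then have "(\<integral>\<^sup>+x. bregman (h x) m \<partial>M) = (\<integral>\<^sup>+x. 0 \<partial>M)"
      using 1 by (intro nn_integral_cong_AE) (auto simp: bregman_def)
    moreover have "(\<integral>\<^sup>+x. ennreal (phi (h x)) \<partial>M) = (\<integral>\<^sup>+x. 1 \<partial>M)"
      using \<open>AE x in M. h x = 0\<close> by (intro nn_integral_cong_AE) (auto simp: phi_def)
    ultimately show ?thesis using 1 by (simp add: phi_def emeasure_space_1)
  next
    case 3
    define B where "B x = h x * ln (h x) - h x * ln m - h x + m" for x
    have phi_int: "integrable M (\<lambda>x. phi (h x))"
      using 3 by (intro integrableI_nonneg) (auto simp: phi_nonneg nonneg)
    have B_eq: "B x = phi (h x) - phi m - (h x - m) * ln m" for x
      by (simp add: B_def phi_def algebra_simps)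
    have B_int: "integrable M B"
      unfolding B_eq[abs_def] using phi_int int by simp
    have breg: "bregman (h x) m = ennreal (B x)" for x
      using 3 by (simp add: bregman_def B_def)
    have B_nonneg: "0 \<le> B x" for x
    proof (cases "h x = 0")
      case False
      then have "ln (m / h x) \<le> m / h x - 1"
        using 3 nonneg[of x] by (intro ln_le_minus_one) auto
      then have "h x * ln (m / h x) \<le> h x * (m / h x - 1)"
        using nonneg by (rule mult_left_mono)
      then show ?thesis
        using False 3 nonneg[of x] by (simp add: B_def ln_div algebra_simps)
    qed (use 3 in \<open>simp add: B_def\<close>)
    have "expectation B = expectation (\<lambda>x. phi (h x)) - phi m - (expectation h - m) * ln m"
      unfolding B_eq[abs_def] using phi_int int by (simp add: prob_space)
    then have "phi m + expectation B = expectation (\<lambda>x. phi (h x))"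
      by (simp add: m_def)
    moreover have "(\<integral>\<^sup>+x. ennreal (phi (h x)) \<partial>M) = ennreal (expectation (\<lambda>x. phi (h x)))"
      using phi_int by (intro nn_integral_eq_integral) (auto simp: phi_nonneg nonneg)
    moreover have "(\<integral>\<^sup>+x. bregman (h x) m \<partial>M) = ennreal (expectation B)"
      unfolding breg using B_int B_nonneg by (intro nn_integral_eq_integral) auto
    moreover have "0 \<le> expectation B" using B_nonneg by simp
    ultimately show ?thesis
      using phi_nonneg[OF m] by (simp flip: ennreal_plus)
  qed simp
  then show ?thesis by (simp add: m_def)
qed

lemma borel_measurable_minus_group [measurable (raw)]:
  fixes f g :: "'a \<Rightarrow> 'b::{second_countable_topology, topological_group_add}"
  assumes "f \<in> borel_measurable M" "g \<in> borel_measurable M"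
  shows "(\<lambda>x. f x - g x) \<in> borel_measurable M"
  using assms by (rule borel_measurable_continuous_Pair) (intro continuous_intros)

section \<open>The convolution and its entropy gain\<close>

text \<open>\<open>\<nu>\<close> stands for the law of \<open>X\<close> and \<open>g\<close> for a
  density of \<open>Y\<close>. Keeping \<open>\<nu>\<close> a general measure lets the same setting
  cover \<open>h(X) = -\<infinity>\<close>.\<close>

locale haar_convolution = haar_group \<mu> + \<nu>: prob_space \<nu>
  for \<mu> :: "'a::compact_connected_metrizable_ab_group measure" and \<nu> :: "'a measure" +
  fixes g :: "'a \<Rightarrow> real"
  assumes sets_\<nu> [simp, measurable_cong]: "sets \<nu> = sets borel"
    and g_measurable [measurable]: "g \<in> borel_measurable borel"
    and g_nonneg: "\<And>x. g x \<ge> 0"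
    and nn_integral_g: "(\<integral>\<^sup>+x. ennreal (g x) \<partial>\<mu>) = 1"
begin

sublocale pair: pair_sigma_finite \<mu> \<nu> ..

lemma space_\<nu> [simp]: "space \<nu> = UNIV"
  using sets_eq_imp_space_eq[OF sets_\<nu>] by simp

lemma emeasure_\<nu>_UNIV [simp]: "emeasure \<nu> UNIV = 1"
  using \<nu>.emeasure_space_1 by simp

text \<open>A density of \<open>X + Y\<close>. The Bochner integral defaults to \<open>0\<close>
  where it diverges, which happens only on a null set.\<close>

definition q :: "'a \<Rightarrow> real" where "q z = (\<integral>x. g (z - x) \<partial>\<nu>)"

text \<open>The mutual information of \<open>X\<close> and \<open>X + Y\<close>, written with a
  nonnegative integrand.\<close>

definition gain :: ennreal where
  "gain = (\<integral>\<^sup>+z. \<integral>\<^sup>+x. bregman (g (z - x)) (q z) \<partial>\<nu> \<partial>\<mu>)"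

lemma borel_pair_cong [measurable_cong]:
  "sets (\<mu> \<Otimes>\<^sub>M \<nu>) = sets (borel \<Otimes>\<^sub>M borel)"
  by (intro sets_pair_measure_cong) auto

lemma q_measurable [measurable]: "q \<in> borel_measurable borel"
proof -
  have "q \<in> borel_measurable \<mu>"
    unfolding q_def[abs_def] by measurable
  then show ?thesis by simp
qed

lemma q_nonneg: "q z \<ge> 0"
  unfolding q_def using g_nonneg by simp

lemma nn_integral_convolution:
  assumes [measurable]: "f \<in> borel_measurable borel"
  shows "(\<integral>\<^sup>+z. \<integral>\<^sup>+x. f (g (z - x)) \<partial>\<nu> \<partial>\<mu>) = (\<integral>\<^sup>+z. f (g z) \<partial>\<mu>)"
proof -
  have "(\<integral>\<^sup>+z. \<integral>\<^sup>+x. f (g (z - x)) \<partial>\<nu> \<partial>\<mu>) = (\<integral>\<^sup>+x. \<integral>\<^sup>+z. f (g (z - x)) \<partial>\<mu> \<partial>\<nu>)"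
    by (rule pair.Fubini'[symmetric]) measurable
  also have "\<dots> = (\<integral>\<^sup>+x. \<integral>\<^sup>+z. f (g z) \<partial>\<mu> \<partial>\<nu>)"
    by (subst nn_integral_translate_diff) auto
  finally show ?thesis by simp
qed

lemma AE_integrable_convolution: "AE z in \<mu>. integrable \<nu> (\<lambda>x. g (z - x))"
proof -
  have "(\<integral>\<^sup>+z. \<integral>\<^sup>+x. ennreal (g (z - x)) \<partial>\<nu> \<partial>\<mu>) = 1"
    using nn_integral_convolution[of ennreal] nn_integral_g by simp
  then have "AE z in \<mu>. (\<integral>\<^sup>+x. ennreal (g (z - x)) \<partial>\<nu>) \<noteq> \<infinity>"
    by (intro nn_integral_noteq_infinite) auto
  then show ?thesis
    by eventually_elim
      (auto intro!: integrableI_nonneg simp: g_nonneg less_top)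
qed

lemma AE_q_eq: "AE z in \<mu>. (\<integral>\<^sup>+x. ennreal (g (z - x)) \<partial>\<nu>) = ennreal (q z)"
  using AE_integrable_convolution
  by eventually_elim (auto simp: q_def g_nonneg nn_integral_eq_integral)

lemma nn_integral_q: "(\<integral>\<^sup>+z. ennreal (q z) \<partial>\<mu>) = 1"
proof -
  have "(\<integral>\<^sup>+z. ennreal (q z) \<partial>\<mu>) = (\<integral>\<^sup>+z. \<integral>\<^sup>+x. ennreal (g (z - x)) \<partial>\<nu> \<partial>\<mu>)"
    using AE_q_eq by (intro nn_integral_cong_AE) auto
  then show ?thesis using nn_integral_convolution[of ennreal] nn_integral_g by simp
qed

text \<open>For almost every \<open>z\<close>, Jensen with defect is applied under
  \<open>\<nu>\<close> to \<open>g (z - x)\<close> as a function of \<open>x\<close>, whose mean is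
  \<open>q z\<close>; translation invariance returns \<open>phi g\<close>. The sum on the left
  avoids subtracting possibly infinite entropies.\<close>

lemma phi_q_plus_gain_le: "(\<integral>\<^sup>+z. ennreal (phi (q z)) \<partial>\<mu>) + gain \<le> (\<integral>\<^sup>+z. ennreal (phi (g z)) \<partial>\<mu>)"
proof -
  have "(\<integral>\<^sup>+z. ennreal (phi (q z)) \<partial>\<mu>) + gain
      = (\<integral>\<^sup>+z. ennreal (phi (q z)) + (\<integral>\<^sup>+x. bregman (g (z - x)) (q z) \<partial>\<nu>) \<partial>\<mu>)"
    unfolding gain_def by (intro nn_integral_add[symmetric]) auto
  also have "\<dots> \<le> (\<integral>\<^sup>+z. \<integral>\<^sup>+x. ennreal (phi (g (z - x))) \<partial>\<nu> \<partial>\<mu>)"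
  proof (rule nn_integral_mono_AE)
    show "AE z in \<mu>. ennreal (phi (q z)) + (\<integral>\<^sup>+x. bregman (g (z - x)) (q z) \<partial>\<nu>)
        \<le> (\<integral>\<^sup>+x. ennreal (phi (g (z - x))) \<partial>\<nu>)"
      using AE_integrable_convolution
      by eventually_elim (unfold q_def, rule \<nu>.bregman_jensen, auto simp: g_nonneg)
  qed
  also have "\<dots> = (\<integral>\<^sup>+z. ennreal (phi (g z)) \<partial>\<mu>)"
    using nn_integral_convolution[of "\<lambda>t. ennreal (phi t)"] by simp
  finally show ?thesis .
qed

end

subsection \<open>Almost periods of the square root density\<close>

lemma sq_diff_le: "a \<ge> 0 \<Longrightarrow> b \<ge> 0 \<Longrightarrow> (a - b)\<^sup>2 \<le> \<bar>a\<^sup>2 - b\<^sup>2\<bar>" for a b :: real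
proof -
  assume "a \<ge> 0" "b \<ge> 0"
  then have "\<bar>a - b\<bar> * \<bar>a - b\<bar> \<le> \<bar>a - b\<bar> * \<bar>a + b\<bar>"
    by (intro mult_left_mono) auto
  then show ?thesis by (simp add: power2_eq_square square_diff_square_factored abs_mult mult.commute)
qed

lemma weighted_sum_square:
  fixes a b c :: real
  assumes "c > 0"
  shows "(a + b)\<^sup>2 \<le> (1 + 1 / c) * a\<^sup>2 + (1 + c) * b\<^sup>2"
proof -
  have "(1 + 1 / c) * a\<^sup>2 + (1 + c) * b\<^sup>2 - (a + b)\<^sup>2 = (a - c * b)\<^sup>2 / c"
    using assms by (simp add: field_simps power2_eq_square)
  moreover have "(a - c * b)\<^sup>2 / c \<ge> 0" using assms by simp
  ultimately show ?thesis by linarith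
qed

context haar_convolution
begin

text \<open>The shift \<open>z = y + x\<close> keeps the value \<open>g y\<close> fixed and lets
  only \<open>q\<close> move, as the estimate of peaks requires.\<close>

lemma gain_translate: "gain = (\<integral>\<^sup>+y. \<integral>\<^sup>+x. bregman (g y) (q (y + x)) \<partial>\<nu> \<partial>\<mu>)"
proof -
  have "gain = (\<integral>\<^sup>+x. \<integral>\<^sup>+z. bregman (g (z - x)) (q z) \<partial>\<mu> \<partial>\<nu>)"
    unfolding gain_def by (rule pair.Fubini'[symmetric]) measurable
  also have "\<dots> = (\<integral>\<^sup>+x. \<integral>\<^sup>+y. bregman (g y) (q (y + x)) \<partial>\<mu> \<partial>\<nu>)"
  proof (rule nn_integral_cong)
    fix x
    show "(\<integral>\<^sup>+z. bregman (g (z - x)) (q z) \<partial>\<mu>) = (\<integral>\<^sup>+y. bregman (g y) (q (y + x)) \<partial>\<mu>)"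
      using nn_integral_translate_diff[of "\<lambda>y. bregman (g y) (q (y + x))" x] by simp
  qed
  also have "\<dots> = (\<integral>\<^sup>+y. \<integral>\<^sup>+x. bregman (g y) (q (y + x)) \<partial>\<nu> \<partial>\<mu>)"
    by (rule pair.Fubini') measurable
  finally show ?thesis .
qed

lemma measure_q_large:
  assumes "M > 0"
  shows "measure \<mu> {z. q z > M} \<le> 1 / M"
proof -
  have "ennreal (M * measure \<mu> {z. q z > M}) = (\<integral>\<^sup>+z. ennreal M * indicator {z. q z > M} z \<partial>\<mu>)"
    using assms by (simp add: nn_integral_cmult_indicator emeasure_eq_measure ennreal_mult)
  also have "\<dots> \<le> (\<integral>\<^sup>+z. ennreal (q z) \<partial>\<mu>)"
    using assms by (intro nn_integral_mono) (auto simp: indicator_def ennreal_leI)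
  finally have "M * measure \<mu> {z. q z > M} \<le> 1"
    by (simp add: nn_integral_q)
  then show ?thesis using assms by (simp add: field_simps)
qed

definition u :: "'a \<Rightarrow> real" where "u x = sqrt (g x)"

text \<open>Squared \<open>L2\<close> distance of \<open>u\<close> from its translates; passing from
  \<open>g\<close> to \<open>u\<close> puts every density into \<open>L2\<close> with norm
  \<open>1\<close>. The points where it is small are the almost periods.\<close>

definition W :: "'a \<Rightarrow> real" where "W t = (\<integral>x. (u (x + t) - u x)\<^sup>2 \<partial>\<mu>)"

lemma u_measurable [measurable]: "u \<in> borel_measurable borel"
  unfolding u_def[abs_def] by measurable

lemma u_nonneg: "u x \<ge> 0"
  by (simp add: u_def g_nonneg)

lemma u_sq: "(u x)\<^sup>2 = g x"
  by (simp add: u_def g_nonneg)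

lemma g_integrable [simp]: "integrable \<mu> g"
  using nn_integral_g by (intro integrableI_nonneg) (auto simp: g_nonneg)

lemma integral_g: "(\<integral>x. g x \<partial>\<mu>) = 1"
  using nn_integral_eq_integral[OF g_integrable] nn_integral_g g_nonneg by simp

lemma integral_u_sq: "(\<integral>x. (u x)\<^sup>2 \<partial>\<mu>) = 1"
  by (simp add: u_sq integral_g)

lemma u_sq_integrable [simp]: "integrable \<mu> (\<lambda>x. (u x)\<^sup>2)"
  by (simp add: u_sq)

lemma u_integrable [simp]: "integrable \<mu> u"
proof (rule Bochner_Integration.integrable_bound[of _ "\<lambda>x. 1 + g x"])
  show "AE x in \<mu>. norm (u x) \<le> norm (1 + g x)"
  proof (rule AE_I2)
    fix x
    have "2 * u x * 1 \<le> (u x)\<^sup>2 + 1\<^sup>2" by (rule sum_squares_bound)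
    then show "norm (u x) \<le> norm (1 + g x)"
      using g_nonneg[of x] u_nonneg[of x] by (simp add: u_sq)
  qed
qed auto

lemma W_integrand_le: "(u (x + t) - u x)\<^sup>2 \<le> \<bar>g (x + t) - g x\<bar>"
  using sq_diff_le[OF u_nonneg u_nonneg, of "x + t" x] by (simp add: u_sq)

lemma W_integrable: "integrable \<mu> (\<lambda>x. (u (x + t) - u x)\<^sup>2)"
proof (rule Bochner_Integration.integrable_bound[of _ "\<lambda>x. \<bar>g (x + t) - g x\<bar>"])
  show "integrable \<mu> (\<lambda>x. \<bar>g (x + t) - g x\<bar>)"
    using integrable_translate[OF g_integrable] by simp
  show "AE x in \<mu>. norm ((u (x + t) - u x)\<^sup>2) \<le> norm \<bar>g (x + t) - g x\<bar>"
    using W_integrand_le by simp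
qed simp

lemma W_nonneg: "W t \<ge> 0"
  by (simp add: W_def)

lemma W_0: "W 0 = 0"
  by (simp add: W_def)

lemma W_le_translation_modulus: "W t \<le> translation_modulus g t"
  unfolding W_def translation_modulus_def
  using integrable_translate[OF g_integrable]
  by (intro integral_mono W_integrable) (auto simp: W_integrand_le)

lemma W_bounded: "W t \<le> 2"
proof -
  have "translation_modulus g t \<le> (\<integral>x. g (x + t) + g x \<partial>\<mu>)"
    unfolding translation_modulus_def using integrable_translate[OF g_integrable]
    by (intro integral_mono) (auto simp: abs_le_iff g_nonneg add_increasing add_increasing2)
  also have "\<dots> = 2"
    using integrable_translate[OF g_integrable] integral_translate[of g t] integral_g by simp
  finally show ?thesis using W_le_translation_modulus[of t] by linarith
qed

lemma W_minus: "W (- t) = W t"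
proof -
  have "W (- t) = (\<integral>x. (u (x + t + - t) - u (x + t))\<^sup>2 \<partial>\<mu>)"
    unfolding W_def by (rule integral_translate[symmetric]) measurable
  then show ?thesis by (simp add: W_def power2_commute)
qed

lemma W_triangle:
  assumes "c > 0"
  shows "W (s + t) \<le> (1 + 1 / c) * W s + (1 + c) * W t"
proof -
  have int: "integrable \<mu> (\<lambda>x. (u (x + t + s) - u (x + t))\<^sup>2)"
    using integrable_translate[OF W_integrable[of s], of t] by simp
  have eq: "(\<integral>x. (u (x + t + s) - u (x + t))\<^sup>2 \<partial>\<mu>) = W s"
    unfolding W_def by (rule integral_translate) measurable
  have "W (s + t) \<le> (\<integral>x. (1 + 1 / c) * (u (x + t + s) - u (x + t))\<^sup>2 + (1 + c) * (u (x + t) - u x)\<^sup>2 \<partial>\<mu>)"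
    unfolding W_def
  proof (intro integral_mono W_integrable Bochner_Integration.integrable_add integrable_mult_right int)
    fix x
    have "u (x + (s + t)) - u x = (u (x + t + s) - u (x + t)) + (u (x + t) - u x)"
      by (simp add: ac_simps)
    then show "(u (x + (s + t)) - u x)\<^sup>2
        \<le> (1 + 1 / c) * (u (x + t + s) - u (x + t))\<^sup>2 + (1 + c) * (u (x + t) - u x)\<^sup>2"
      using weighted_sum_square[OF assms] by metis
  qed
  also have "\<dots> = (1 + 1 / c) * W s + (1 + c) * W t"
    using int W_integrable[of t] by (simp add: eq) (simp add: W_def)
  finally show ?thesis .
qed

lemma W_continuous: "continuous_on UNIV W"
proof (rule quasi_triangle_continuous[where W = W, OF W_nonneg W_bounded W_minus W_triangle])
  fix T :: "nat \<Rightarrow> 'a" assume "T \<longlonglongrightarrow> 0"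
  then have "(\<lambda>n. translation_modulus g (T n)) \<longlonglongrightarrow> 0"
    by (intro translation_modulus_tendsto_0) auto
  then show "(\<lambda>n. W (T n)) \<longlonglongrightarrow> 0"
    by (rule Lim_null_comparison[rotated])
      (auto intro!: always_eventually simp: W_nonneg W_le_translation_modulus)
qed

text \<open>The double integral of \<open>W\<close> is twice the variance of \<open>u\<close>; as \<open>u\<close> has unit norm, its mean \<open>m\<close>
  satisfies \<open>0 \<le> m \<le> 1\<close>, so \<open>2 - 2 m \<le> 2 - 2 m\<^sup>2\<close>.\<close>

lemma sqrt_diff_le_W:
  assumes C: "\<And>t. W t \<le> C"
  shows "(\<integral>\<^sup>+x. ennreal ((u x - 1)\<^sup>2) \<partial>\<mu>) \<le> ennreal C"
proof -
  define m where "m = (\<integral>x. u x \<partial>\<mu>)"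
  define v where "v a = (\<integral>t. (u t - a)\<^sup>2 \<partial>\<mu>)" for a
  have expand: "(u t - a)\<^sup>2 = (u t)\<^sup>2 - 2 * a * u t + a\<^sup>2" for t a
    by (simp add: power2_diff)
  have v_eq: "v a = 1 - 2 * a * m + a\<^sup>2" for a
    unfolding v_def expand by (simp add: prob_space m_def integral_u_sq)
  have v_nn: "ennreal (v a) = (\<integral>\<^sup>+t. ennreal ((u t - a)\<^sup>2) \<partial>\<mu>)" for a
  proof -
    have "integrable \<mu> (\<lambda>t. (u t - a)\<^sup>2)" by (simp add: expand)
    then show ?thesis unfolding v_def by (simp add: nn_integral_eq_integral)
  qed
  have v_nonneg: "v a \<ge> 0" for a by (simp add: v_def)
  have "m \<ge> 0" unfolding m_def using u_nonneg by simp
  moreover have "m \<le> 1" using v_nonneg[of 1] v_eq[of 1] by simp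
  ultimately have "m\<^sup>2 \<le> m" by (simp add: power2_eq_square mult_left_le)
  then have "ennreal (v 1) \<le> ennreal (2 - 2 * m\<^sup>2)"
    unfolding v_eq by (intro ennreal_leI) simp
  also have "2 - 2 * m\<^sup>2 = (\<integral>z. v (u z) \<partial>\<mu>)"
    unfolding v_eq by (simp add: prob_space m_def integral_u_sq) (simp add: power2_eq_square)
  also have "ennreal \<dots> = (\<integral>\<^sup>+z. ennreal (v (u z)) \<partial>\<mu>)"
    by (intro nn_integral_eq_integral[symmetric]) (auto simp: v_nonneg, simp add: v_eq)
  also have "\<dots> = (\<integral>\<^sup>+z. \<integral>\<^sup>+t. ennreal ((u (z + t) - u z)\<^sup>2) \<partial>\<mu> \<partial>\<mu>)"
  proof (intro nn_integral_cong)
    fix z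
    show "ennreal (v (u z)) = (\<integral>\<^sup>+t. ennreal ((u (z + t) - u z)\<^sup>2) \<partial>\<mu>)"
      using nn_integral_translate[of "\<lambda>t. ennreal ((u t - u z)\<^sup>2)" z]
      by (simp add: v_nn add.commute)
  qed
  also have "\<dots> = (\<integral>\<^sup>+t. \<integral>\<^sup>+z. ennreal ((u (z + t) - u z)\<^sup>2) \<partial>\<mu> \<partial>\<mu>)"
    by (rule pair_sigma_finite.Fubini'[symmetric]) (unfold_locales, measurable)
  also have "\<dots> = (\<integral>\<^sup>+t. ennreal (W t) \<partial>\<mu>)"
    unfolding W_def
    by (intro nn_integral_cong nn_integral_eq_integral W_integrable) simp
  also have "\<dots> \<le> (\<integral>\<^sup>+t. ennreal C \<partial>\<mu>)"
    by (intro nn_integral_mono ennreal_leI C)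
  also have "\<dots> = ennreal C" using emeasure_space_1 by simp
  finally show ?thesis by (simp add: v_nn)
qed


text \<open>Squared Hellinger distance, up to normalisation, between the laws of
  \<open>x + Y\<close> and \<open>X + Y\<close>; its mean over \<open>\<nu>\<close> is at most
  \<open>gain\<close>.\<close>

definition \<rho> :: "'a \<Rightarrow> ennreal" where
  "\<rho> x = (\<integral>\<^sup>+z. ennreal ((sqrt (g (z - x)) - sqrt (q z))\<^sup>2) \<partial>\<mu>)"

lemma \<rho>_measurable [measurable]: "\<rho> \<in> borel_measurable borel"
proof -
  have "\<rho> \<in> borel_measurable \<mu>" unfolding \<rho>_def[abs_def] by measurable
  then show ?thesis by simp
qed

lemma nn_integral_\<rho>_le: "(\<integral>\<^sup>+x. \<rho> x \<partial>\<nu>) \<le> gain"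
proof -
  have "(\<integral>\<^sup>+x. \<rho> x \<partial>\<nu>) = (\<integral>\<^sup>+z. \<integral>\<^sup>+x. ennreal ((sqrt (g (z - x)) - sqrt (q z))\<^sup>2) \<partial>\<nu> \<partial>\<mu>)"
    unfolding \<rho>_def by (rule pair.Fubini') measurable
  also have "\<dots> \<le> gain"
    unfolding gain_def by (intro nn_integral_mono bregman_ge_sqrt_diff g_nonneg q_nonneg)
  finally show ?thesis .
qed

text \<open>Two points where \<open>\<rho>\<close> is small differ by an almost period of \<open>u\<close>, by comparison with \<open>sqrt q\<close>.\<close>

lemma W_diff_le:
  assumes "\<rho> x \<le> ennreal r" "\<rho> y \<le> ennreal r" "r \<ge> 0"
  shows "W (x - y) \<le> 4 * r"
proof -
  have "ennreal (W (x - y)) = (\<integral>\<^sup>+z. ennreal ((u (z + (x - y)) - u z)\<^sup>2) \<partial>\<mu>)"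
    unfolding W_def by (intro nn_integral_eq_integral[symmetric] W_integrable) simp
  also have "\<dots> = (\<integral>\<^sup>+z. ennreal ((u (z - x + (x - y)) - u (z - x))\<^sup>2) \<partial>\<mu>)"
    by (rule nn_integral_translate_diff[symmetric]) measurable
  also have "\<dots> = (\<integral>\<^sup>+z. ennreal ((u (z - y) - u (z - x))\<^sup>2) \<partial>\<mu>)" by simp
  also have "\<dots> \<le> (\<integral>\<^sup>+z. 2 * ennreal ((sqrt (g (z - y)) - sqrt (q z))\<^sup>2)
      + 2 * ennreal ((sqrt (g (z - x)) - sqrt (q z))\<^sup>2) \<partial>\<mu>)"
  proof (rule nn_integral_mono)
    fix z
    have "(u (z - y) - u (z - x))\<^sup>2
        \<le> 2 * (u (z - y) - sqrt (q z))\<^sup>2 + 2 * (u (z - x) - sqrt (q z))\<^sup>2"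
      using weighted_sum_square[of 1 "u (z - y) - sqrt (q z)" "sqrt (q z) - u (z - x)"]
      by (simp add: power2_commute)
    then show "ennreal ((u (z - y) - u (z - x))\<^sup>2)
        \<le> 2 * ennreal ((sqrt (g (z - y)) - sqrt (q z))\<^sup>2) + 2 * ennreal ((sqrt (g (z - x)) - sqrt (q z))\<^sup>2)"
      by (subst (1 2) ennreal_numeral[symmetric])
        (auto simp: u_def simp flip: ennreal_mult ennreal_plus intro!: ennreal_leI simp del: ennreal_numeral)
  qed
  also have "\<dots> = 2 * \<rho> y + 2 * \<rho> x"
    unfolding \<rho>_def by (simp add: nn_integral_add nn_integral_cmult)
  also have "\<dots> \<le> 2 * ennreal r + 2 * ennreal r"
    using assms by (intro add_mono mult_left_mono) auto
  also have "\<dots> = ennreal (4 * r)"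
    using assms(3) by (simp add: ennreal_mult flip: distrib_right)
  finally show ?thesis using assms(3) by (simp add: ennreal_le_iff)
qed

lemma measure_\<rho>_large:
  assumes "gain \<le> ennreal \<Gamma>" "\<Gamma> \<ge> 0" "3 * \<Gamma> \<le> r" "r > 0"
  shows "measure \<nu> {x. \<not> \<rho> x \<le> ennreal r} \<le> 1 / 3"
proof -
  let ?S = "{x. \<not> \<rho> x \<le> ennreal r}"
  have "ennreal (r * measure \<nu> ?S) = (\<integral>\<^sup>+x. ennreal r * indicator ?S x \<partial>\<nu>)"
    using assms by (simp add: nn_integral_cmult_indicator \<nu>.emeasure_eq_measure ennreal_mult)
  also have "\<dots> \<le> (\<integral>\<^sup>+x. \<rho> x \<partial>\<nu>)"
    by (intro nn_integral_mono) (auto simp: indicator_def not_le intro: less_imp_le)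
  also have "\<dots> \<le> ennreal \<Gamma>" using nn_integral_\<rho>_le assms(1) by (rule order_trans)
  finally have "r * measure \<nu> ?S \<le> \<Gamma>" using assms(2) by (simp add: ennreal_le_iff)
  then have "r * (3 * measure \<nu> ?S) \<le> r * 1" using assms(3) by linarith
  then show ?thesis using assms(4) by simp
qed


section \<open>The two regimes when the law of \<open>X\<close> is spread out\<close>

context
  fixes K :: real
  assumes K: "K \<ge> 1"
    and spread: "\<And>S. S \<in> sets borel \<Longrightarrow> measure \<nu> S \<le> 1 / 6 + K * measure \<mu> S"
begin

text \<open>By Markov, \<open>\<rho>\<close> is at most \<open>r\<close> on a set of
  \<open>\<nu>\<close>-mass at least \<open>2 / 3\<close>, and \<open>spread\<close> gives this set
  Haar measure at least \<open>1 / (2 * K)\<close>. Subtracting one of its points yields almost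
  periods, and connectedness reaches every \<open>t\<close> at the cost
  \<open>(3 * 2 * K)^2\<close>; times \<open>12 * \<Gamma>\<close> this is the stated
  constant.\<close>

lemma W_le:
  assumes \<Gamma>: "gain \<le> ennreal \<Gamma>" "\<Gamma> \<ge> 0"
  shows "W t \<le> 432 * K\<^sup>2 * \<Gamma>"
proof -
  \<comment> \<open>The almost periods satisfy \<open>W \<le> 4 * r\<close> with
    \<open>r \<ge> 3 * \<Gamma>\<close>. A \<open>\<delta>\<close> strictly above
    \<open>12 * \<Gamma>\<close> leaves room for a positive \<open>r\<close> even when
    \<open>\<Gamma> = 0\<close>; \<open>dense_ge\<close> then takes the limit.\<close>
  have "W t / (36 * K\<^sup>2) \<le> \<delta>" if \<delta>: "12 * \<Gamma> < \<delta>" for \<delta>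
  proof -
    define r where "r = (3 * \<Gamma> + \<delta> / 4) / 2"
    have r: "3 * \<Gamma> \<le> r" "r > 0" "4 * r < \<delta>" using \<delta> \<Gamma>(2) by (auto simp: r_def)
    let ?F = "{x. \<rho> x \<le> ennreal r}"
    have "measure \<nu> ?F = 1 - measure \<nu> {x. \<not> \<rho> x \<le> ennreal r}"
      by (subst \<nu>.prob_compl[symmetric]) (auto intro!: arg_cong[where f = "measure \<nu>"])
    then have "2 / 3 \<le> measure \<nu> ?F" using measure_\<rho>_large[OF \<Gamma> r(1,2)] by simp
    also have "\<dots> \<le> 1 / 6 + K * measure \<mu> ?F" by (rule spread) measurable
    finally have F: "1 / (2 * K) \<le> measure \<mu> ?F" using K by (simp add: field_simps)
    then have "measure \<mu> ?F \<noteq> 0" using K by (smt (verit) divide_pos_pos)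
    then have "?F \<noteq> {}" by (metis measure_empty)
    then obtain y where y: "\<rho> y \<le> ennreal r" by blast
    have [measurable]: "W \<in> borel_measurable borel"
      by (rule borel_measurable_continuous_onI[OF W_continuous])
    have "measure \<mu> ?F \<le> measure \<mu> {x. x + - y \<in> {t. W t < \<delta>}}"
    proof (rule finite_measure_mono)
      show "?F \<subseteq> {x. x + - y \<in> {t. W t < \<delta>}}"
        using W_diff_le[OF _ y, of _] r by fastforce
    qed measurable
    also have "\<dots> = measure \<mu> {t. W t < \<delta>}" by (rule measure_translate) measurable
    finally have "1 / (2 * K) \<le> measure \<mu> {t. W t < \<delta>}" using F by linarith
    then have "W t \<le> (3 / (1 / (2 * K)))\<^sup>2 * \<delta>"
      using K r \<delta> by (intro sublevel_growth[OF W_0 W_minus W_continuous W_triangle]) auto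
    then show ?thesis using K by (simp add: field_simps power2_eq_square)
  qed
  then have "W t / (36 * K\<^sup>2) \<le> 12 * \<Gamma>" by (rule dense_ge)
  then show ?thesis using K by (simp add: field_simps)
qed

text \<open>As \<open>q\<close> has integral \<open>1\<close>, it exceeds \<open>6 * K\<close> only
  on Haar measure at most \<open>1 / (6 * K)\<close>, hence for fixed \<open>y\<close> on
  \<open>\<nu>\<close>-mass at most \<open>1 / 6 + 1 / 6\<close> of the shifts. On the remaining two
  thirds at least half of \<open>phi (g y)\<close> is gained, a share of \<open>1 / 3\<close> in
  all.\<close>

lemma peak_le:
  "(\<integral>\<^sup>+y. ennreal (phi (g y)) * indicator {y. (exp 1 * (6 * K))\<^sup>2 \<le> g y} y \<partial>\<mu>) \<le> 3 * gain"
proof -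
  let ?M = "6 * K"
  have large: "2 / 3 \<le> measure \<nu> {x. q (y + x) \<le> ?M}" for y
  proof -
    have eq: "{x. x + y \<in> {z. q z > ?M}} = {x. \<not> q (y + x) \<le> ?M}"
      by (auto simp: add.commute)
    have "measure \<nu> {x. \<not> q (y + x) \<le> ?M} \<le> 1 / 6 + K * measure \<mu> {x. \<not> q (y + x) \<le> ?M}"
      by (rule spread) measurable
    also have "measure \<mu> {x. \<not> q (y + x) \<le> ?M} = measure \<mu> {z. q z > ?M}"
      unfolding eq[symmetric] by (rule measure_translate) measurable
    also have "K * \<dots> \<le> K * (1 / ?M)"
      using K by (intro mult_left_mono measure_q_large) auto
    also have "\<dots> = 1 / 6" using K by simp
    finally have "measure \<nu> {x. \<not> q (y + x) \<le> ?M} \<le> 1 / 3" by simp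
    moreover have "measure \<nu> {x. q (y + x) \<le> ?M} = 1 - measure \<nu> {x. \<not> q (y + x) \<le> ?M}"
      by (subst \<nu>.prob_compl[symmetric]) (auto intro!: arg_cong[where f = "measure \<nu>"])
    ultimately show ?thesis by simp
  qed
  have "ennreal (phi (g y)) * indicator {y. (exp 1 * ?M)\<^sup>2 \<le> g y} y
      \<le> 3 * (\<integral>\<^sup>+x. bregman (g y) (q (y + x)) \<partial>\<nu>)" for y
  proof (cases "(exp 1 * ?M)\<^sup>2 \<le> g y")
    case True
    let ?S = "{x. q (y + x) \<le> ?M}"
    have p: "0 \<le> phi (g y)" by (rule phi_nonneg[OF g_nonneg])
    have "phi (g y) * (2 / 3) \<le> phi (g y) * measure \<nu> ?S"
      using p large by (rule mult_left_mono[rotated])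
    then have "ennreal (phi (g y)) \<le> ennreal (3 * (phi (g y) / 2 * measure \<nu> ?S))"
      by (intro ennreal_leI) simp
    also have "\<dots> = ennreal 3 * (ennreal (phi (g y) / 2) * ennreal (measure \<nu> ?S))"
      using p by (simp add: ennreal_mult del: times_divide_eq_right times_divide_eq_left)
    also have "\<dots> = 3 * (ennreal (phi (g y) / 2) * emeasure \<nu> ?S)"
      by (simp add: \<nu>.emeasure_eq_measure)
    also have "ennreal (phi (g y) / 2) * emeasure \<nu> ?S = (\<integral>\<^sup>+x. ennreal (phi (g y) / 2) * indicator ?S x \<partial>\<nu>)"
      by (rule nn_integral_cmult_indicator[symmetric]) measurable
    also have "\<dots> \<le> (\<integral>\<^sup>+x. bregman (g y) (q (y + x)) \<partial>\<nu>)"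
    proof (rule nn_integral_mono)
      fix x
      show "ennreal (phi (g y) / 2) * indicator ?S x \<le> bregman (g y) (q (y + x))"
        using bregman_ge_half_phi[of ?M "g y" "q (y + x)"] K True q_nonneg
        by (cases "x \<in> ?S") auto
    qed
    finally show ?thesis using True by (simp add: mult_left_mono)
  qed simp
  then have "(\<integral>\<^sup>+y. ennreal (phi (g y)) * indicator {y. (exp 1 * ?M)\<^sup>2 \<le> g y} y \<partial>\<mu>)
      \<le> (\<integral>\<^sup>+y. 3 * (\<integral>\<^sup>+x. bregman (g y) (q (y + x)) \<partial>\<nu>) \<partial>\<mu>)"
    by (intro nn_integral_mono)
  also have "\<dots> = 3 * gain"
    unfolding gain_translate by (rule nn_integral_cmult) measurable
  finally show ?thesis .
qed

text \<open>The density is split at the level \<open>L\<close> of \<open>peak_le\<close>. Below it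
  \<open>phi\<close> is compared with \<open>(u - 1)^2\<close>, whose integral is at most any
  uniform bound on \<open>W\<close>.\<close>

lemma phi_integral_le_gain:
  assumes \<Gamma>: "gain = ennreal \<Gamma>" "\<Gamma> \<ge> 0"
  shows "(\<integral>\<^sup>+y. ennreal (phi (g y)) \<partial>\<mu>)
    \<le> ennreal ((3 + (4 + ln ((exp 1 * (6 * K))\<^sup>2)) * (432 * K\<^sup>2)) * \<Gamma>)"
proof -
  define L where "L = (exp 1 * (6 * K))\<^sup>2"
  define C where "C = 432 * K\<^sup>2 * \<Gamma>"
  have "1 * 1 \<le> exp 1 * (6 * K)" using K by (intro mult_mono) auto
  then have L: "1 \<le> L" unfolding L_def by (intro one_le_power) simp
  have C: "C \<ge> 0" using \<Gamma> by (simp add: C_def)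
  have "(\<integral>\<^sup>+y. ennreal (phi (g y)) \<partial>\<mu>)
      \<le> (\<integral>\<^sup>+y. ennreal (phi (g y)) * indicator {y. L \<le> g y} y
          + ennreal (4 + ln L) * ennreal ((u y - 1)\<^sup>2) \<partial>\<mu>)"
  proof (rule nn_integral_mono)
    fix y
    show "ennreal (phi (g y)) \<le> ennreal (phi (g y)) * indicator {y. L \<le> g y} y
          + ennreal (4 + ln L) * ennreal ((u y - 1)\<^sup>2)"
    proof (cases "L \<le> g y")
      case False
      then have "phi (g y) \<le> (4 + ln L) * (u y - 1)\<^sup>2"
        using phi_le_sqrt_diff[of "g y" L] g_nonneg L by (simp add: u_def)
      then have "ennreal (phi (g y)) \<le> ennreal (4 + ln L) * ennreal ((u y - 1)\<^sup>2)"
        using L by (subst ennreal_mult[symmetric]) (auto intro: ennreal_leI)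
      then show ?thesis using False by simp
    qed simp
  qed
  also have "\<dots> = (\<integral>\<^sup>+y. ennreal (phi (g y)) * indicator {y. L \<le> g y} y \<partial>\<mu>)
      + ennreal (4 + ln L) * (\<integral>\<^sup>+y. ennreal ((u y - 1)\<^sup>2) \<partial>\<mu>)"
    by (simp add: nn_integral_add nn_integral_cmult)
  also have "\<dots> \<le> 3 * gain + ennreal (4 + ln L) * ennreal C"
    using peak_le sqrt_diff_le_W[of C] W_le[of \<Gamma>] \<Gamma> unfolding L_def C_def
    by (intro add_mono mult_left_mono) auto
  also have "\<dots> = ennreal (3 * \<Gamma>) + ennreal ((4 + ln L) * C)"
    using \<Gamma> L C by (simp add: ennreal_mult)
  also have "\<dots> = ennreal (3 * \<Gamma> + (4 + ln L) * C)"
    using \<Gamma> L C by (subst ennreal_plus) auto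
  finally show ?thesis unfolding C_def L_def by (simp add: algebra_simps)
qed

end

end

subsection \<open>Comparison of the constants\<close>

lemma sin_ge_cubic:
  assumes "0 \<le> (x::real)"
  shows "x - x ^ 3 / 6 \<le> sin x"
proof -
  have cos_le: "1 - x\<^sup>2 / 2 \<le> cos x" for x :: real
    using cos_double_sin[of "x / 2"] abs_sin_x_le_abs_x[of "x / 2"]
      power_mono[of "\<bar>sin (x / 2)\<bar>" "\<bar>x / 2\<bar>" 2]
    by (simp add: power2_eq_square field_simps)
  have "sin 0 - (0 - 0 ^ 3 / 6) \<le> sin x - (x - x ^ 3 / 6)"
  proof (rule DERIV_nonneg_imp_nondecreasing[OF assms])
    fix y :: real
    show "\<exists>d. ((\<lambda>x. sin x - (x - x ^ 3 / 6)) has_real_derivative d) (at y) \<and> d \<ge> 0"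
    proof (intro exI conjI)
      show "((\<lambda>x. sin x - (x - x ^ 3 / 6)) has_real_derivative (cos y - (1 - y\<^sup>2 / 2))) (at y)"
        by (auto intro!: derivative_eq_intros)
      show "cos y - (1 - y\<^sup>2 / 2) \<ge> 0" using cos_le[of y] by simp
    qed
  qed
  then show ?thesis by simp
qed

lemma sinc_sq_ge:
  assumes "0 < (x::real)" "x\<^sup>2 \<le> 6"
  shows "1 - x\<^sup>2 / 3 \<le> (sin x / x)\<^sup>2"
proof -
  have "1 - x\<^sup>2 / 6 \<le> sin x / x"
    using sin_ge_cubic[of x] assms by (simp add: field_simps power3_eq_cube power2_eq_square)
  \<comment> \<open>Squaring is monotone here because \<open>x^2 \<le> 6\<close> keeps the smaller
    base nonnegative.\<close>
  then have "(1 - x\<^sup>2 / 6)\<^sup>2 \<le> (sin x / x)\<^sup>2"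
    using assms by (intro power_mono) auto
  moreover have "(1 - x\<^sup>2 / 6)\<^sup>2 = 1 - x\<^sup>2 / 3 + (x\<^sup>2 / 6)\<^sup>2"
    by (simp add: power2_diff)
  moreover have "0 \<le> (x\<^sup>2 / 6)\<^sup>2" by simp
  ultimately show ?thesis by linarith
qed

lemma pi_sq_le_10: "pi\<^sup>2 \<le> 10"
proof -
  have "pi\<^sup>2 \<le> (3.16::real)\<^sup>2"
    using pi_approx by (intro power_mono) auto
  then show ?thesis by (simp add: power2_eq_square)
qed

text \<open>Quadratic Taylor bound at \<open>1 / 4\<close>, raised to the fourth power. The tenth
  power of \<open>2.68\<close> has to exceed \<open>25 / 36 * 20739\<close>, about 14402, in
  \<open>growth_constant_le\<close>.\<close>

lemma exp_1_ge: "2.68 \<le> exp (1::real)"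
proof -
  have "1 + 1 / 4 + (1 / 4)\<^sup>2 / 2 \<le> exp (1 / 4 :: real)"
    by (rule exp_lower_Taylor_quadratic) simp
  then have "(1.28 :: real) ^ 4 \<le> exp (1 / 4) ^ 4"
    by (intro power_mono) (auto simp: power2_eq_square)
  also have "\<dots> = exp (1::real)" by (simp flip: exp_of_nat_mult)
  finally show ?thesis by (simp add: power4_eq_xxxx)
qed

text \<open>The claimed constant is of order \<open>s^5\<close>: \<open>1 - \<eta>\<close> is at
  most \<open>pi^2 * s^2 / 3\<close>, and the denominator is at least \<open>16 / s\<close>.\<close>

lemma spectral_constant_le:
  assumes s: "0 < s" "s \<le> 3 / 20" and \<eta>: "\<eta> = (sin (pi * s) / (pi * s))\<^sup>2"
  shows "(1 - \<eta>)\<^sup>2 / (8 + 16 * \<eta> / s) \<le> 25 / 36 * s ^ 5"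
proof -
  have s2: "s\<^sup>2 \<le> 3 / 20 * s" using s by (simp add: power2_eq_square)
  have "(pi * s)\<^sup>2 \<le> 10 * s\<^sup>2"
    using pi_sq_le_10 by (simp add: power_mult_distrib mult_right_mono)
  moreover from this have "1 - (pi * s)\<^sup>2 / 3 \<le> \<eta>"
    unfolding \<eta> using s s2 by (intro sinc_sq_ge) auto
  ultimately have lower: "1 - \<eta> \<le> 10 / 3 * s\<^sup>2" by simp
  have "\<bar>sin (pi * s)\<bar> \<le> \<bar>pi * s\<bar>" by (rule abs_sin_x_le_abs_x)
  then have "\<bar>sin (pi * s) / (pi * s)\<bar> \<le> 1" using s by (simp add: abs_mult)
  then have "\<eta> \<le> 1" unfolding \<eta> by (simp add: power_le_one_iff abs_square_le_1)
  then have num: "(1 - \<eta>)\<^sup>2 \<le> (10 / 3 * s\<^sup>2)\<^sup>2"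
    using lower by (intro power_mono) auto
  \<comment> \<open>Since \<open>\<eta> \<ge> 1 - 10 / 3 * s^2\<close>, it suffices that
    \<open>10 / 3 * s^2 \<le> s / 2\<close>; this fixes the range
    \<open>s \<le> 3 / 20\<close>.\<close>
  have "1 \<le> \<eta> + s / 2" using lower s2 s by linarith
  then have "16 / s * 1 \<le> 16 / s * (\<eta> + s / 2)"
    using s by (intro mult_left_mono) auto
  then have den: "16 / s \<le> 8 + 16 * \<eta> / s"
    using s by (simp add: field_simps)
  have "(1 - \<eta>)\<^sup>2 / (8 + 16 * \<eta> / s) \<le> (10 / 3 * s\<^sup>2)\<^sup>2 / (16 / s)"
    using num den s by (intro frac_le) auto
  also have "\<dots> = 25 / 36 * s ^ 5"
    using s by (simp add: field_simps power2_eq_square eval_nat_numeral)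
  finally show ?thesis .
qed

text \<open>With \<open>E = exp (2 * d)\<close> the growth constant is at most
  \<open>20739 * E^13\<close>, that is \<open>20739 * exp (26 * d)\<close>, while
  \<open>s^5 = exp (- 30 * d - 10)\<close>. The product decreases in \<open>d\<close>, and at
  \<open>d = 0\<close> the factor \<open>exp (- 10)\<close> suffices.\<close>

lemma growth_constant_le:
  fixes d :: real
  assumes d: "d \<ge> 0" and K: "K = 2 * exp (12 * d)" and s: "s = exp (- 6 * d - 2)"
  shows "25 / 36 * s ^ 5 * (3 + (4 + ln ((exp 1 * (6 * K))\<^sup>2)) * (432 * K\<^sup>2)) \<le> 1"
proof -
  define E where "E = exp (2 * d)"
  have E: "E \<ge> 1 + 2 * d" unfolding E_def by (rule exp_ge_add_one_self)
  have E1: "E \<ge> 1" using E d by simp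
  have K2: "K\<^sup>2 = 4 * E ^ 12"
    by (simp add: K E_def power_mult_distrib flip: exp_of_nat_mult)
  have "(2.5::real) ^ 3 \<le> exp 1 ^ 3"
    using exp_1_ge by (intro power_mono) auto
  moreover have "exp 1 ^ 3 = exp (3::real)" by (simp flip: exp_of_nat_mult)
  ultimately have "(12::real) \<le> exp 3" by (simp add: power3_eq_cube)
  then have "ln (12::real) \<le> ln (exp 3)" by (intro ln_mono) auto
  then have ln12: "ln (12::real) \<le> 3" by simp
  have "ln ((exp 1 * (6 * K))\<^sup>2) = 2 * (1 + ln 12 + 12 * d)"
    by (simp add: K ln_realpow ln_mult)
  \<comment> \<open>The logarithmic factor is at most \<open>12 * (1 + 2 * d)\<close>, so it costs a
    single further power of \<open>E\<close>.\<close>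
  then have "4 + ln ((exp 1 * (6 * K))\<^sup>2) \<le> 12 * E"
    using ln12 E by simp
  then have "(4 + ln ((exp 1 * (6 * K))\<^sup>2)) * (432 * K\<^sup>2) \<le> 12 * E * (432 * (4 * E ^ 12))"
    unfolding K2 using E1 by (intro mult_right_mono) auto
  also have "\<dots> = 20736 * E ^ 13" by (simp add: eval_nat_numeral)
  finally have "3 + (4 + ln ((exp 1 * (6 * K))\<^sup>2)) * (432 * K\<^sup>2) \<le> 20739 * E ^ 13"
    using one_le_power[OF E1, of 13] by linarith
  then have "25 / 36 * s ^ 5 * (3 + (4 + ln ((exp 1 * (6 * K))\<^sup>2)) * (432 * K\<^sup>2))
      \<le> 25 / 36 * s ^ 5 * (20739 * E ^ 13)"
    by (intro mult_left_mono) (auto simp: s)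
  also have "\<dots> = 25 / 36 * 20739 * exp (- 4 * d - 10)"
    by (simp add: s E_def algebra_simps flip: exp_of_nat_mult exp_add)
  also have "\<dots> \<le> 25 / 36 * 20739 * exp (- 10)" using d by simp
  also have "\<dots> \<le> 1"
  proof -
    have "(2.68::real) ^ 10 \<le> exp 1 ^ 10"
      using exp_1_ge by (intro power_mono) auto
    moreover have "exp 1 ^ 10 = exp (10::real)" by (simp flip: exp_of_nat_mult)
    ultimately have "25 / 36 * 20739 \<le> exp (10::real)" by (simp add: eval_nat_numeral)
    then show ?thesis by (simp add: exp_minus field_simps)
  qed
  finally show ?thesis .
qed

text \<open>By convexity \<open>phi\<close> lies above its tangent at
  \<open>K = 2 * exp (12 * d)\<close>, whose slope \<open>ln 2 + 12 * d\<close> exceeds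
  \<open>1 / 6 + 6 * d\<close>; so it is enough that the tangent is above the line at
  \<open>t = K\<close>.\<close>

lemma phi_tail:
  assumes d: "d \<ge> 0" and t: "2 * exp (12 * d) \<le> t"
  shows "(1 / 6 + 6 * d) * t \<le> phi t"
proof -
  define K where "K = 2 * exp (12 * d)"
  have K: "K > 0" "t > 0" "K \<le> t" using t by (auto simp: K_def intro: less_le_trans[OF _ t])
  have "ln (K / t) \<le> K / t - 1" using K by (intro ln_le_minus_one) auto
  then have "t * ln (K / t) \<le> t * (K / t - 1)" using K by (intro mult_left_mono) auto
  then have tangent: "t * ln K - K + 1 \<le> phi t"
    using K by (simp add: phi_def ln_div algebra_simps)
  have lnK: "ln K = ln 2 + 12 * d" by (simp add: K_def ln_mult)
  \<comment> \<open>At \<open>t = K\<close> both quantities are compared with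
    \<open>1 / 2 + 6 * d\<close>: it bounds \<open>1 - 1 / K\<close> from above by this inequality,
    and \<open>ln K - 1 / 6 - 6 * d\<close> from below by \<open>ln 2 \<ge> 2 / 3\<close>.\<close>
  have "1 + - (12 * d) \<le> exp (- (12 * d))" by (rule exp_ge_add_one_self)
  then have "1 / 2 - 6 * d \<le> 1 / K" by (simp add: K_def exp_minus field_simps)
  then have "0 \<le> ln K - 1 / 6 - 6 * d - (1 - 1 / K)"
    using ln2_ge_two_thirds lnK by simp
  then have "K * (1 - 1 / K) \<le> K * (ln K - 1 / 6 - 6 * d)"
    using K by (intro mult_left_mono) auto
  also have "\<dots> \<le> t * (ln K - 1 / 6 - 6 * d)"
    using K d lnK ln2_ge_two_thirds by (intro mult_right_mono) auto
  finally show ?thesis using tangent K by (simp add: algebra_simps)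
qed

subsection \<open>Entropy as an integral\<close>

context haar_group
begin

text \<open>Where the density is at most \<open>K\<close>, it contributes at most \<open>K\<close>
  times Haar measure. Above \<open>K\<close>, \<open>phi_tail\<close> bounds it by
  \<open>c * phi\<close>, of total mass \<open>c * d \<le> 1 / 6\<close>.\<close>

lemma density_spread:
  assumes [measurable]: "f \<in> borel_measurable borel" and nonneg: "\<And>x. f x \<ge> 0"
    and d: "(\<integral>\<^sup>+x. ennreal (phi (f x)) \<partial>\<mu>) = ennreal d" "d \<ge> 0"
    and S [measurable]: "S \<in> sets borel"
  shows "measure (density \<mu> (\<lambda>x. ennreal (f x))) S \<le> 1 / 6 + 2 * exp (12 * d) * measure \<mu> S"
proof -
  define c where "c = 1 / (1 / 6 + 6 * d)"
  define K where "K = 2 * exp (12 * d)"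
  have c: "c > 0" using d by (simp add: c_def)
  have K: "K > 0" by (simp add: K_def)
  have "emeasure (density \<mu> (\<lambda>x. ennreal (f x))) S = (\<integral>\<^sup>+x. ennreal (f x) * indicator S x \<partial>\<mu>)"
    by (simp add: emeasure_density)
  also have "\<dots> \<le> (\<integral>\<^sup>+x. ennreal c * ennreal (phi (f x)) + ennreal K * indicator S x \<partial>\<mu>)"
  proof (rule nn_integral_mono)
    fix x
    show "ennreal (f x) * indicator S x
        \<le> ennreal c * ennreal (phi (f x)) + ennreal K * indicator S x"
    proof (cases "f x \<le> K")
      case True
      then have "ennreal (f x) * indicator S x \<le> ennreal K * indicator S x"
        by (intro mult_right_mono ennreal_leI) auto
      then show ?thesis by (simp add: add_increasing)
    next
      case False
      then have "(1 / 6 + 6 * d) * f x \<le> phi (f x)"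
        using phi_tail[OF d(2), of "f x"] by (simp add: K_def)
      then have "c * ((1 / 6 + 6 * d) * f x) \<le> c * phi (f x)"
        using c by (intro mult_left_mono) auto
      moreover have "c * ((1 / 6 + 6 * d) * f x) = f x"
        using d by (simp add: c_def)
      ultimately have "ennreal (f x) \<le> ennreal (c * phi (f x))"
        by (intro ennreal_leI) linarith
      also have "\<dots> = ennreal c * ennreal (phi (f x))"
        using c phi_nonneg[OF nonneg] by (intro ennreal_mult) auto
      finally show ?thesis
        by (auto simp: indicator_def intro: add_increasing2)
    qed
  qed
  also have "\<dots> = ennreal c * ennreal d + ennreal K * emeasure \<mu> S"
    by (simp add: nn_integral_add nn_integral_cmult nn_integral_cmult_indicator d)
  also have "\<dots> = ennreal (c * d + K * measure \<mu> S)"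
    using c K d by (simp add: emeasure_eq_measure ennreal_mult)
  finally have "measure (density \<mu> (\<lambda>x. ennreal (f x))) S \<le> c * d + K * measure \<mu> S"
    unfolding measure_def using c K d by (intro enn2real_leI) (auto simp: measure_def)
  moreover have "c * d \<le> 1 / 6" using d by (simp add: c_def field_simps)
  ultimately show ?thesis by (simp add: K_def)
qed

lemma distr_haar_eq: "distr M \<mu> X = distr M borel X"
  by (rule distr_cong) auto

lemma real_density:
  assumes "prob_space M" "haar_entropy M \<mu> X \<noteq> - \<infinity>"
  obtains f where "f \<in> borel_measurable borel" "\<And>x. f x \<ge> 0"
    "distr M borel X = density \<mu> (\<lambda>x. ennreal (f x))"
proof -
  obtain f where "distributed M \<mu> X f"
    using assms(2) unfolding haar_entropy_def by (auto split: if_splits)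
  then have f [measurable]: "f \<in> borel_measurable borel" and X: "X \<in> measurable M borel"
    and eq: "distr M borel X = density \<mu> f"
    by (auto simp: distributed_def distr_haar_eq cong: measurable_cong_sets)
  interpret D: prob_space "distr M borel X"
    using assms(1) X by (rule prob_space.prob_space_distr)
  have "(\<integral>\<^sup>+x. f x \<partial>\<mu>) = 1"
    using D.emeasure_space_1 unfolding eq by (simp add: emeasure_density)
  then have "AE x in \<mu>. f x \<noteq> \<infinity>"
    by (intro nn_integral_noteq_infinite) auto
  then have "AE x in \<mu>. f x = ennreal (enn2real (f x))"
    by eventually_elim (simp add: less_top)
  then have "density \<mu> f = density \<mu> (\<lambda>x. ennreal (enn2real (f x)))"
    by (intro density_cong) auto
  then show ?thesis using that[of "\<lambda>x. enn2real (f x)"] eq by simp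
qed

text \<open>Positive and negative parts are kept apart: \<open>phi + f\<close> plus the negative
  part of \<open>f ln f\<close> equals the positive part plus \<open>1\<close>. Integrating and
  cancelling \<open>1\<close> gives \<open>I + P = Q\<close>; as \<open>P\<close> is finite,
  \<open>P - Q = - I\<close> even if \<open>Q\<close> is infinite.\<close>

lemma haar_entropy_eq:
  assumes M: "prob_space M" and X: "X \<in> measurable M borel"
    and f [measurable]: "f \<in> borel_measurable borel" and nonneg: "\<And>x. f x \<ge> 0"
    and eq: "distr M borel X = density \<mu> (\<lambda>x. ennreal (f x))"
  shows "haar_entropy M \<mu> X = - enn2ereal (\<integral>\<^sup>+x. ennreal (phi (f x)) \<partial>\<mu>)"
proof -
  have dist: "distributed M \<mu> X (\<lambda>x. ennreal (f x))"
    using X eq by (simp add: distributed_def distr_haar_eq)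
  interpret D: prob_space "distr M borel X"
    using M X by (rule prob_space.prob_space_distr)
  have f1: "(\<integral>\<^sup>+x. ennreal (f x) \<partial>\<mu>) = 1"
    using D.emeasure_space_1 unfolding eq by (simp add: emeasure_density)
  have "AE x in \<mu>. ennreal (f x) = RN_deriv \<mu> (distr M \<mu> X) x"
    using eq by (intro RN_deriv_unique) (auto simp: distr_haar_eq)
  then have RN: "AE x in \<mu>. enn2real (RN_deriv \<mu> (distr M \<mu> X) x) = f x"
    by eventually_elim (metis enn2real_ennreal nonneg)
  define P where "P = (\<integral>\<^sup>+x. ennreal (- (f x * ln (f x))) \<partial>\<mu>)"
  define Q where "Q = (\<integral>\<^sup>+x. ennreal (f x * ln (f x)) \<partial>\<mu>)"
  define I where "I = (\<integral>\<^sup>+x. ennreal (phi (f x)) \<partial>\<mu>)"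
  have "haar_entropy M \<mu> X = enn2ereal P - enn2ereal Q"
  proof -
    have "(\<integral>\<^sup>+x. ennreal (- (enn2real (RN_deriv \<mu> (distr M \<mu> X) x)
        * ln (enn2real (RN_deriv \<mu> (distr M \<mu> X) x)))) \<partial>\<mu>) = P"
      unfolding P_def using RN by (intro nn_integral_cong_AE) auto
    moreover have "(\<integral>\<^sup>+x. ennreal (enn2real (RN_deriv \<mu> (distr M \<mu> X) x)
        * ln (enn2real (RN_deriv \<mu> (distr M \<mu> X) x))) \<partial>\<mu>) = Q"
      unfolding Q_def using RN by (intro nn_integral_cong_AE) auto
    ultimately show ?thesis
      using dist unfolding haar_entropy_def by (auto simp: Let_def)
  qed
  moreover have "I + P = Q" and "P \<noteq> \<top>"
  proof -
    \<comment> \<open>From \<open>phi \<ge> 0\<close>: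
      \<open>f ln f \<ge> f - 1 \<ge> - 1\<close>.\<close>
    have "- (f x * ln (f x)) \<le> 1" for x
      using phi_nonneg[OF nonneg[of x]] nonneg[of x] by (simp add: phi_def)
    then have "P \<le> (\<integral>\<^sup>+x. 1 \<partial>\<mu>)"
      unfolding P_def by (intro nn_integral_mono) (metis ennreal_1 ennreal_leI)
    also have "\<dots> = 1" using emeasure_space_1 by simp
    finally show P: "P \<noteq> \<top>" by (auto simp: top_unique)
    have pointwise: "ennreal (phi (f x)) + ennreal (f x) + ennreal (- (f x * ln (f x)))
        = ennreal (f x * ln (f x)) + 1" for x
    proof -
      have "ennreal (phi (f x)) + ennreal (f x) = ennreal (f x * ln (f x) + 1)"
        using phi_nonneg[OF nonneg[of x]] nonneg[of x]
        by (subst ennreal_plus[symmetric]) (auto simp: phi_def)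
      moreover have "0 \<le> f x * ln (f x) + 1"
        using phi_nonneg[OF nonneg[of x]] nonneg[of x] by (simp add: phi_def)
      ultimately show ?thesis
        by (cases "f x * ln (f x) \<ge> 0")
          (auto simp: ennreal_neg simp flip: ennreal_plus ennreal_1)
    qed
    have "I + 1 + P = (\<integral>\<^sup>+x. ennreal (phi (f x)) + ennreal (f x) + ennreal (- (f x * ln (f x))) \<partial>\<mu>)"
      unfolding I_def P_def f1[symmetric] by (simp add: nn_integral_add)
    also have "\<dots> = (\<integral>\<^sup>+x. ennreal (f x * ln (f x)) + 1 \<partial>\<mu>)"
      unfolding pointwise ..
    also have "\<dots> = Q + 1"
      unfolding Q_def using emeasure_space_1 by (simp add: nn_integral_add)
    finally have "1 + (I + P) = 1 + Q" by (simp add: ac_simps)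
    then show "I + P = Q" by (simp add: ennreal_add_left_cancel)
  qed
  ultimately show ?thesis
    unfolding I_def[symmetric]
    by (cases I; cases P; cases Q) (auto simp: plus_ennreal.rep_eq simp flip: ennreal_plus)
qed

text \<open>The divergence is a Bochner integral of \<open>f ln f = phi + f - 1\<close>; a finite
  integral of \<open>phi\<close> makes this integrable, so the real value is the true one.\<close>

lemma rel_entropy_uniform_eq:
  assumes M: "prob_space M" and Y: "Y \<in> measurable M borel"
    and f [measurable]: "f \<in> borel_measurable borel" and nonneg: "\<And>x. f x \<ge> 0"
    and eq: "distr M borel Y = density \<mu> (\<lambda>x. ennreal (f x))"
    and I: "(\<integral>\<^sup>+x. ennreal (phi (f x)) \<partial>\<mu>) = ennreal I" "I \<ge> 0"
  shows "rel_entropy_uniform M \<mu> Y = I"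
proof -
  interpret D: prob_space "distr M borel Y"
    using M Y by (rule prob_space.prob_space_distr)
  have f1: "(\<integral>\<^sup>+x. ennreal (f x) \<partial>\<mu>) = 1"
    using D.emeasure_space_1 unfolding eq by (simp add: emeasure_density)
  have int_f: "integrable \<mu> f"
    using f1 nonneg by (intro integrableI_nonneg) auto
  have "ennreal (\<integral>x. f x \<partial>\<mu>) = 1"
    using f1 nonneg by (subst nn_integral_eq_integral[OF int_f, symmetric]) auto
  then have f_1: "(\<integral>x. f x \<partial>\<mu>) = 1" by simp
  have int_phi: "integrable \<mu> (\<lambda>x. phi (f x))"
    using I phi_nonneg[OF nonneg] by (intro integrableI_nonneg) auto
  have "ennreal (\<integral>x. phi (f x) \<partial>\<mu>) = ennreal I"
    using I phi_nonneg[OF nonneg] by (subst nn_integral_eq_integral[OF int_phi, symmetric]) auto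
  then have I_eq: "(\<integral>x. phi (f x) \<partial>\<mu>) = I"
    using I(2) phi_nonneg[OF nonneg] by (subst (asm) ennreal_inj) (auto intro: integral_nonneg)
  have "rel_entropy_uniform M \<mu> Y = (\<integral>x. f x * log (exp 1) (f x) \<partial>\<mu>)"
    unfolding rel_entropy_uniform_def distr_haar_eq eq using nonneg
    by (intro KL_density) auto
  also have "\<dots> = (\<integral>x. phi (f x) + f x - 1 \<partial>\<mu>)"
    by (simp add: log_def phi_def)
  also have "\<dots> = I" using int_phi int_f by (simp add: I_eq f_1)
  finally show ?thesis .
qed

end

section \<open>The law of the sum\<close>

lemma (in haar_convolution) distr_add:
  assumes "prob_space M" and indep: "prob_space.indep_var M borel X borel Y"
    and X: "distr M borel X = \<nu>" and Y: "distr M borel Y = density \<mu> (\<lambda>x. ennreal (g x))"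
  shows "distr M borel (\<lambda>\<omega>. X \<omega> + Y \<omega>) = density \<mu> (\<lambda>z. ennreal (q z))"
proof (rule measure_eqI)
  interpret M: prob_space M by fact
  have XY [measurable]: "X \<in> measurable M borel" "Y \<in> measurable M borel"
    and joint: "distr M borel X \<Otimes>\<^sub>M distr M borel Y = distr M (borel \<Otimes>\<^sub>M borel) (\<lambda>\<omega>. (X \<omega>, Y \<omega>))"
    using indep unfolding M.indep_var_distribution_eq by auto
  interpret DY: prob_space "distr M borel Y" by (rule M.prob_space_distr) measurable
  fix A assume "A \<in> sets (distr M borel (\<lambda>\<omega>. X \<omega> + Y \<omega>))"
  then have A [measurable]: "A \<in> sets borel" by simp
  have "emeasure (distr M borel (\<lambda>\<omega>. X \<omega> + Y \<omega>)) A
      = (\<integral>\<^sup>+\<omega>. indicator A (X \<omega> + Y \<omega>) \<partial>M)"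
  proof -
    have "emeasure (distr M borel (\<lambda>\<omega>. X \<omega> + Y \<omega>)) A
        = (\<integral>\<^sup>+z. indicator A z \<partial>distr M borel (\<lambda>\<omega>. X \<omega> + Y \<omega>))" by simp
    also have "\<dots> = (\<integral>\<^sup>+\<omega>. indicator A (X \<omega> + Y \<omega>) \<partial>M)"
      by (rule nn_integral_distr) measurable
    finally show ?thesis .
  qed
  also have "\<dots> = (\<integral>\<^sup>+p. indicator A (fst p + snd p) \<partial>distr M (borel \<Otimes>\<^sub>M borel) (\<lambda>\<omega>. (X \<omega>, Y \<omega>)))"
    by (subst nn_integral_distr) auto
  also have "\<dots> = (\<integral>\<^sup>+x. \<integral>\<^sup>+y. indicator A (x + y) \<partial>distr M borel Y \<partial>\<nu>)"
    unfolding joint[symmetric] X by (subst DY.nn_integral_fst[symmetric]) auto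
  also have "\<dots> = (\<integral>\<^sup>+x. \<integral>\<^sup>+y. ennreal (g y) * indicator A (x + y) \<partial>\<mu> \<partial>\<nu>)"
    unfolding Y by (intro nn_integral_cong nn_integral_density) auto
  also have "\<dots> = (\<integral>\<^sup>+x. \<integral>\<^sup>+z. ennreal (g (z - x)) * indicator A z \<partial>\<mu> \<partial>\<nu>)"
  proof (rule nn_integral_cong)
    fix x
    show "(\<integral>\<^sup>+y. ennreal (g y) * indicator A (x + y) \<partial>\<mu>) = (\<integral>\<^sup>+z. ennreal (g (z - x)) * indicator A z \<partial>\<mu>)"
      using nn_integral_translate_diff[of "\<lambda>y. ennreal (g y) * indicator A (x + y)" x] by simp
  qed
  also have "\<dots> = (\<integral>\<^sup>+z. \<integral>\<^sup>+x. ennreal (g (z - x)) * indicator A z \<partial>\<nu> \<partial>\<mu>)"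
    by (rule pair.Fubini') measurable
  also have "\<dots> = (\<integral>\<^sup>+z. ennreal (q z) * indicator A z \<partial>\<mu>)"
  proof (rule nn_integral_cong_AE)
    show "AE z in \<mu>. (\<integral>\<^sup>+x. ennreal (g (z - x)) * indicator A z \<partial>\<nu>) = ennreal (q z) * indicator A z"
      using AE_q_eq by eventually_elim (simp add: nn_integral_multc)
  qed
  also have "\<dots> = emeasure (density \<mu> (\<lambda>z. ennreal (q z))) A"
    by (simp add: emeasure_density)
  finally show "emeasure (distr M borel (\<lambda>\<omega>. X \<omega> + Y \<omega>)) A
      = emeasure (density \<mu> (\<lambda>z. ennreal (q z))) A" .
qed simp

section \<open>Entropy increase in terms of \<open>h(X)\<close>\<close>

theorem theorem1p4:
  fixes M :: "'m measure"
    and \<mu> :: "'a::compact_connected_metrizable_ab_group measure"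
    and X Y :: "'m \<Rightarrow> 'a"
    and s \<eta> :: real
  assumes haar: "haar_probability \<mu>"
    and prob: "prob_space M"
    and indep: "prob_space.indep_var M borel X borel Y"
    and max_entropy: "max (haar_entropy M \<mu> X) (haar_entropy M \<mu> Y) = haar_entropy M \<mu> Y"
    and finite_entropy: "haar_entropy M \<mu> Y > - \<infinity>"
    and s: "s = (if haar_entropy M \<mu> X = - \<infinity> then 0
                 else exp (6 * real_of_ereal (haar_entropy M \<mu> X) - 2))"
    and \<eta>: "\<eta> = (if s = 0 then 1 else (sin (pi * s) / (pi * s))\<^sup>2)"
  shows "haar_entropy M \<mu> (\<lambda>\<omega>. X \<omega> + Y \<omega>) - haar_entropy M \<mu> Y
     \<ge> ereal ((if s = 0 then 0 else min (1 / 4) ((1 - \<eta>)\<^sup>2 / (8 + 16 * \<eta> / s)))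
               * rel_entropy_uniform M \<mu> Y)"
proof -
  interpret M: prob_space M by fact
  interpret haar_group \<mu> by unfold_locales fact
  have XY [measurable]: "X \<in> measurable M borel" "Y \<in> measurable M borel"
    using indep unfolding M.indep_var_distribution_eq by auto
  interpret \<nu>: prob_space "distr M borel X" by (rule M.prob_space_distr) measurable
  interpret DY: prob_space "distr M borel Y" by (rule M.prob_space_distr) measurable
  obtain g where g [measurable]: "g \<in> borel_measurable borel" and g0: "\<And>x. g x \<ge> 0"
    and Yg: "distr M borel Y = density \<mu> (\<lambda>x. ennreal (g x))"
    using real_density[OF prob, of Y] finite_entropy by auto
  have g1: "(\<integral>\<^sup>+x. ennreal (g x) \<partial>\<mu>) = 1"
    using DY.emeasure_space_1 unfolding Yg by (simp add: emeasure_density)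
  interpret conv: haar_convolution \<mu> "distr M borel X" g
    by unfold_locales (auto simp: g0 g1)
  have hY: "haar_entropy M \<mu> Y = - enn2ereal (\<integral>\<^sup>+x. ennreal (phi (g x)) \<partial>\<mu>)"
    by (rule haar_entropy_eq[OF prob _ g g0 Yg]) measurable
  have hXY: "haar_entropy M \<mu> (\<lambda>\<omega>. X \<omega> + Y \<omega>) = - enn2ereal (\<integral>\<^sup>+x. ennreal (phi (conv.q x)) \<partial>\<mu>)"
    by (rule haar_entropy_eq[OF prob _ _ conv.q_nonneg conv.distr_add[OF prob indep refl Yg]]) measurable
  have "(\<integral>\<^sup>+x. ennreal (phi (g x)) \<partial>\<mu>) \<noteq> \<top>"
    using finite_entropy unfolding hY by auto
  then obtain Dg where Dg: "(\<integral>\<^sup>+x. ennreal (phi (g x)) \<partial>\<mu>) = ennreal Dg" "Dg \<ge> 0"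
    by (metis ennreal_cases)
  have rel: "rel_entropy_uniform M \<mu> Y = Dg"
    by (rule rel_entropy_uniform_eq[OF prob _ g g0 Yg Dg]) measurable
  have "(\<integral>\<^sup>+x. ennreal (phi (conv.q x)) \<partial>\<mu>) + conv.gain \<le> ennreal Dg"
    using conv.phi_q_plus_gain_le Dg by simp
  \<comment> \<open>Finiteness of \<open>Dg\<close> forces both summands to be finite, so the
    entropy difference is the real number \<open>Dg - Dq\<close>, which is at least
    \<open>\<Gamma>\<close>.\<close>
  then obtain Dq \<Gamma> where Dq: "(\<integral>\<^sup>+x. ennreal (phi (conv.q x)) \<partial>\<mu>) = ennreal Dq" "Dq \<ge> 0"
    and \<Gamma>: "conv.gain = ennreal \<Gamma>" "\<Gamma> \<ge> 0" and le: "Dq + \<Gamma> \<le> Dg"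
    using Dg(2)
    by (cases "(\<integral>\<^sup>+x. ennreal (phi (conv.q x)) \<partial>\<mu>)"; cases conv.gain)
      (auto simp: top_unique simp flip: ennreal_plus)
  have lhs: "haar_entropy M \<mu> (\<lambda>\<omega>. X \<omega> + Y \<omega>) - haar_entropy M \<mu> Y = ereal (Dg - Dq)"
    using Dg Dq by (simp add: hXY hY)
  show ?thesis
  proof (cases "haar_entropy M \<mu> X = - \<infinity>")
    case True
    \<comment> \<open>Here \<open>s = 0\<close> and the right side vanishes, so
      \<open>\<Gamma> \<ge> 0\<close> is enough.\<close>
    then show ?thesis using s lhs le \<Gamma> by simp
  next
    case False
    obtain f where f [measurable]: "f \<in> borel_measurable borel" and f0: "\<And>x. f x \<ge> 0"
      and Xf: "distr M borel X = density \<mu> (\<lambda>x. ennreal (f x))"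
      using real_density[OF prob False] by auto
    have hX: "haar_entropy M \<mu> X = - enn2ereal (\<integral>\<^sup>+x. ennreal (phi (f x)) \<partial>\<mu>)"
      by (rule haar_entropy_eq[OF prob _ f f0 Xf]) measurable
    have "(\<integral>\<^sup>+x. ennreal (phi (f x)) \<partial>\<mu>) \<noteq> \<top>"
      using False unfolding hX by auto
    then obtain d where d: "(\<integral>\<^sup>+x. ennreal (phi (f x)) \<partial>\<mu>) = ennreal d" "d \<ge> 0"
      by (metis ennreal_cases)
    have s_eq: "s = exp (- 6 * d - 2)" using s False d by (simp add: hX)
    define K where "K = 2 * exp (12 * d)"
    define C where "C = 3 + (4 + ln ((exp 1 * (6 * K))\<^sup>2)) * (432 * K\<^sup>2)"
    have "1 \<le> exp (12 * d)" using d by simp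
    then have K: "K \<ge> 1" unfolding K_def by linarith
    have "ennreal Dg \<le> ennreal (C * \<Gamma>)"
      unfolding C_def Dg(1)[symmetric]
    proof (rule conv.phi_integral_le_gain[OF K _ \<Gamma>])
      fix S :: "'a set" assume "S \<in> sets borel"
      then show "measure (distr M borel X) S \<le> 1 / 6 + K * measure \<mu> S"
        unfolding Xf K_def by (intro density_spread f0 d) auto
    qed
    moreover have "0 \<le> C"
    proof -
      have "1 * 1 \<le> exp 1 * (6 * K)" using K by (intro mult_mono) auto
      then have "0 \<le> ln ((exp 1 * (6 * K))\<^sup>2)" by (intro ln_ge_zero one_le_power) simp
      then show ?thesis by (simp add: C_def)
    qed
    ultimately have Dg_le: "Dg \<le> C * \<Gamma>" using \<Gamma> by (simp add: ennreal_le_iff)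
    \<comment> \<open>As \<open>d \<ge> 0\<close>, \<open>s\<close> is at most
      \<open>exp (- 2)\<close>; with \<open>exp 2 \<ge> 20 / 3\<close> this lies in the range of
      \<open>spectral_constant_le\<close>.\<close>
    have "exp (2::real) = exp 1 * exp 1" by (simp flip: exp_add)
    then have "20 / 3 \<le> exp (2::real)"
      using mult_mono[OF exp_1_ge exp_1_ge] by simp
    then have "exp (- 2) \<le> (3 / 20 :: real)" by (simp add: exp_minus field_simps)
    moreover have "s \<le> exp (- 2)" using d by (simp add: s_eq)
    moreover have "0 < s" by (simp add: s_eq)
    ultimately have s_bounds: "0 < s" "s \<le> 3 / 20" by linarith+
    let ?c = "min (1 / 4) ((1 - \<eta>)\<^sup>2 / (8 + 16 * \<eta> / s))"
    have "?c \<le> 25 / 36 * s ^ 5"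
    proof (rule min.coboundedI2, rule spectral_constant_le[OF s_bounds])
      show "\<eta> = (sin (pi * s) / (pi * s))\<^sup>2" using \<eta> s_bounds by simp
    qed
    then have "?c * Dg \<le> 25 / 36 * s ^ 5 * Dg" using Dg(2) by (rule mult_right_mono)
    also have "\<dots> \<le> 25 / 36 * s ^ 5 * (C * \<Gamma>)"
      using Dg_le s_bounds by (intro mult_left_mono) auto
    also have "\<dots> = (25 / 36 * s ^ 5 * C) * \<Gamma>" by simp
    \<comment> \<open>The bound \<open>25 / 36 * s^5\<close> on the claimed constant, times
      \<open>C\<close>, is at most \<open>1\<close>: the decay \<open>exp (- 30 * d)\<close> beats
      the growth \<open>exp (26 * d)\<close>.\<close>
    also have "\<dots> \<le> 1 * \<Gamma>"
      unfolding C_def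
      using growth_constant_le[OF d(2) K_def s_eq] \<Gamma>(2) by (rule mult_right_mono)
    finally have "?c * Dg \<le> Dg - Dq" using le by linarith
    then show ?thesis using s_bounds by (simp add: lhs rel)
  qed
qed

end
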